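(* (a) For every integer $n\ge 6$, $g_n=1-f_n(n-1)\le \dfrac{1}{n}$. (b) For all integers $m,n$ such that $5\le m<n$, $f_n(m)\ge \dfrac{m}{n}$.
   Context: $\Delta(\cdot)$ denotes area in the Euclidean plane. For integers $n,m$ with $3\le m\le n-1$, define $$f_n(m)=\min_{P\in\mathcal{P}_n}\ \max_{Q\subset P,\ |Q|=m}\frac{\Delta(Q)}{\Delta(P)},$$ where $\mathcal{P}_n$ is the class of all convex $n$-gons in the plane and, for each $P$, the maximum is taken over all convex $m$-gons $Q$ contained in $P$ ($|Q|$ denotes the number of vertices of $Q$). For an integer $n\ge 4$, define $$g_n=\max\ \min_{1\le k\le n}\frac{\Delta(A_{k-1}A_kA_{k+1})}{\Delta(A_1A_2\ldots A_n)},$$ where the maximum is taken over all convex $n$-gons $A_1A_2\ldots A_n$ in the plane (vertices listed in cyclic order), and vertex indices are taken modulo $n$ (so $A_0=A_n$ and $A_{n+1}=A_1$). *)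

theory Defs
  imports "HOL-Analysis.Analysis"
begin

abbreviation area :: "(real^2) set \<Rightarrow> real" where
  "area \<equiv> measure lebesgue"

(* A convex polygon is the closed region, and its vertices are its extreme points.
   Three extreme points in the plane are never collinear, so n >= 3 already forces
   nonempty interior and hence positive area. *)
definition convex_ngon :: "nat \<Rightarrow> (real^2) set \<Rightarrow> bool" where
  "convex_ngon n P \<longleftrightarrow> n \<ge> 3 \<and> polytope P \<and> card {v. v extreme_point_of P} = n"

(* The vertices are A 1, ..., A n; the values A 0 and A (n + 1) realise the convention
   that indices are taken modulo n, and other values of A are irrelevant.
   The extreme points of the hull lie among A 1, ..., A n, so having n of them makes these
   points distinct and all extreme. The vertices of a convex polygon are joined by its edges
   into a single cycle, so the edge condition says exactly that they are listed in cyclic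
   order (in either orientation). *)
definition cyclic_vertices :: "nat \<Rightarrow> (nat \<Rightarrow> real^2) \<Rightarrow> bool" where
  "cyclic_vertices n A \<longleftrightarrow>
     A 0 = A n \<and> A (n + 1) = A 1 \<and>
     convex_ngon n (convex hull (A ` {1..n})) \<and>
     (\<forall>k\<in>{1..n}. closed_segment (A k) (A (k + 1)) edge_of (convex hull (A ` {1..n})))"

(* f_n(m). The minimum over P and the maximum over Q are rendered as infimum and supremum,
   which agree with them whenever these are attained; both are over nonempty sets of numbers
   in [0,1] for 3 <= m < n. *)
definition f_ratio :: "nat \<Rightarrow> nat \<Rightarrow> real" where
  "f_ratio n m =
     (INF P\<in>{P. convex_ngon n P}.
        SUP Q\<in>{Q. convex_ngon m Q \<and> Q \<subseteq> P}. area Q / area P)"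

(* g_n, with the maximum over polygons rendered as a supremum in the same way. *)
definition g_ratio :: "nat \<Rightarrow> real" where
  "g_ratio n =
     (SUP A\<in>{A. cyclic_vertices n A}.
        MIN k\<in>{1..n}.
          area (convex hull {A (k - 1), A k, A (k + 1)}) / area (convex hull (A ` {1..n})))"

end

theory Submission
  imports Defs
begin

text \<open>Everything rests on one inequality: a convex \<open>n\<close>-gon of area \<open>S\<close> with \<open>n \<ge> 6\<close> has a vertex whose
ear (the triangle it spans with its two neighbours) has area at most \<open>S / n\<close>. Cutting off that
ear leaves a convex \<open>(n - 1)\<close>-gon of area at least \<open>(n - 1) / n * S\<close>, and cutting off one vertex
after the other until \<open>m\<close> are left multiplies these factors to \<open>m / n\<close>, which is part (b). This
works as long as every polygon that is cut has at least six vertices, that is, for \<open>m \<ge> 5\<close>.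

The inequality is proved by induction on \<open>n\<close>. In a hexagon, the pairwise intersections of the
three main diagonals serve as apexes of six triangles, one over each side. An apex lies on the
diagonal between the outer neighbours of its side, so by linearity its triangle has at least the
area of one of the two ears containing that side; and the six triangles together are at most the
hexagon, the difference being the triangle of the three intersection points
(\<open>hexagon_ear_bound\<close>). For \<open>n \<ge> 7\<close>, let \<open>e\<close> be the area of the smallest ear. The sides make one
full turn in total, so two sharp turns cannot be far apart, and there is a vertex whose removal
only enlarges the ears of its neighbours (\<open>exists_removable_vertex\<close>). The \<open>(n - 1)\<close>-gon that
remains has area at most \<open>S - e\<close> and no ear smaller than \<open>e\<close>, so \<open>(n - 1) * e \<le> S - e\<close>
(\<open>ear_bound\<close>).

The equality in part (a) says that the largest \<open>(n - 1)\<close>-gon inside \<open>P\<close> arises by cutting off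
the smallest ear of \<open>P\<close>. Indeed, the area of a polygon does not decrease when a vertex moves
away from the line through its neighbours, so the vertices of an inscribed polygon may be moved
one at a time to vertices of \<open>P\<close> (\<open>move_to_corners\<close>); fewer than \<open>n\<close> vertices of \<open>P\<close> miss some
vertex.

A convex polygon is handled as an \<open>n\<close>-periodic sequence of points all of whose triples in one
period turn left (\<open>convex_cycle\<close>). Such a sequence exists for every polygon (\<open>exists_cycle\<close>),
and the ears of the cyclic listings of the vertices given by edges are its ears
(\<open>cyclic_vertices_ear\<close>, \<open>cyclic_vertices_of_cycle\<close>).\<close>

section \<open>Signed areas in the plane\<close>

definition wedge :: "real^2 \<Rightarrow> real^2 \<Rightarrow> real" where
  "wedge x y = x$1 * y$2 - x$2 * y$1"

text \<open>Twice the signed area of a triangle, positive if it is listed counterclockwise.\<close>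
definition orient :: "real^2 \<Rightarrow> real^2 \<Rightarrow> real^2 \<Rightarrow> real" where
  "orient a b c = wedge (b - a) (c - a)"

lemmas orient_expand = orient_def wedge_def

lemma orient_rotate: "orient b c a = orient a b c"
  by (simp add: orient_expand algebra_simps)

lemma orient_swap: "orient a c b = - orient a b c"
  by (simp add: orient_expand algebra_simps)

lemma orient_degenerate [simp]: "orient a a b = 0" "orient a b a = 0" "orient a b b = 0"
  by (simp_all add: orient_expand algebra_simps)

text \<open>For fixed \<open>a\<close> and \<open>b\<close>, orientation is an affine functional, so facts on half spaces and
hyperplanes apply to it.\<close>
lemma orient_inner:
  obtains w where "\<And>x. orient a b x = w \<bullet> x - w \<bullet> a" "a \<noteq> b \<Longrightarrow> w \<noteq> 0"
proof
  let ?w = "vector [a$2 - b$2, b$1 - a$1] :: real^2"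
  show "orient a b x = ?w \<bullet> x - ?w \<bullet> a" for x
    by (simp add: orient_expand inner_vec_def sum_2 algebra_simps)
  show "?w \<noteq> 0" if "a \<noteq> b"
    using that by (auto simp: vec_eq_iff forall_2)
qed

lemma convex_half_planes:
  "convex {x. orient a b x \<ge> 0}" "convex {x. orient a b x \<le> 0}"
  "convex {x. orient a b x > 0}"
proof -
  obtain w where w: "\<And>x. orient a b x = w \<bullet> x - w \<bullet> a"
    using orient_inner by metis
  show "convex {x. orient a b x \<ge> 0}" using convex_halfspace_ge[of "w \<bullet> a" w] by (simp add: w)
  show "convex {x. orient a b x \<le> 0}" using convex_halfspace_le[of w "w \<bullet> a"] by (simp add: w)
  show "convex {x. orient a b x > 0}" using convex_halfspace_gt[of "w \<bullet> a" w] by (simp add: w)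
qed

lemma orient_hull:
  assumes "y \<in> convex hull S"
  shows "(\<And>x. x \<in> S \<Longrightarrow> orient a b x \<ge> 0) \<Longrightarrow> orient a b y \<ge> 0"
    and "(\<And>x. x \<in> S \<Longrightarrow> orient a b x \<le> 0) \<Longrightarrow> orient a b y \<le> 0"
    and "(\<And>x. x \<in> S \<Longrightarrow> orient a b x > 0) \<Longrightarrow> orient a b y > 0"
proof -
  have "P y" if "convex {x. P x}" "\<And>x. x \<in> S \<Longrightarrow> P x" for P
    using assms hull_minimal[of S "{x. P x}" convex] that by auto
  note * = this
  show "(\<And>x. x \<in> S \<Longrightarrow> orient a b x \<ge> 0) \<Longrightarrow> orient a b y \<ge> 0"
    and "(\<And>x. x \<in> S \<Longrightarrow> orient a b x \<le> 0) \<Longrightarrow> orient a b y \<le> 0"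
    and "(\<And>x. x \<in> S \<Longrightarrow> orient a b x > 0) \<Longrightarrow> orient a b y > 0"
    by (fact *[OF convex_half_planes(1)] *[OF convex_half_planes(2)] *[OF convex_half_planes(3)])+
qed

lemma negligible_line:
  assumes "a \<noteq> b"
  shows "negligible {x. orient a b x = 0}"
proof -
  obtain w where w: "\<And>x. orient a b x = w \<bullet> x - w \<bullet> a" "w \<noteq> 0"
    using orient_inner assms by metis
  show ?thesis using negligible_hyperplane[of w "w \<bullet> a"] w by simp
qed

section \<open>Splitting off a triangle\<close>

lemma hull_lmeasurable: "finite S \<Longrightarrow> convex hull S \<in> lmeasurable" for S :: "(real^2) set"
  by (simp add: finite_imp_compact_convex_hull lmeasurable_compact)

lemma area_hull_mono:
  fixes S T :: "(real^2) set"
  assumes "finite S" "finite T" "convex hull S \<subseteq> convex hull T"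
  shows "area (convex hull S) \<le> area (convex hull T)"
  using assms hull_lmeasurable measure_mono_fmeasurable by (metis fmeasurableD)

lemma area_triangle: "area (convex hull {a, b, c}) = \<bar>orient a b c\<bar> / 2"
proof -
  have "area (convex hull {a, b, c}) = measure lborel (convex hull {a, b, c})"
    by (intro measure_completion) (simp add: finite_imp_compact_convex_hull borel_compact)
  then show ?thesis
    by (simp add: content_triangle orient_expand algebra_simps abs_minus_commute)
qed

lemma area_hull_Un:
  assumes "finite S" "finite T" "a \<noteq> b"
    and "\<And>x. x \<in> S \<Longrightarrow> orient a b x \<ge> 0" "\<And>x. x \<in> T \<Longrightarrow> orient a b x \<le> 0"
  shows "area (convex hull S \<union> convex hull T) = area (convex hull S) + area (convex hull T)"
proof -
  have "convex hull S \<inter> convex hull T \<subseteq> {x. orient a b x = 0}"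
    using orient_hull(1)[of _ S a b] orient_hull(2)[of _ T a b] assms(4,5) by force
  then have "negligible (convex hull S \<inter> convex hull T)"
    using negligible_line[OF assms(3)] negligible_subset by blast
  then have "area (convex hull S \<inter> convex hull T) = 0"
    using negligible_imp_measure0 by blast
  then show ?thesis
    using measure_Un3[OF hull_lmeasurable hull_lmeasurable, OF assms(1,2)] by simp
qed

text \<open>The triangle and the hull of \<open>S\<close> lie on different sides of the line \<open>ab\<close>, so they overlap in a
null set only.\<close>
lemma area_add_triangle_le:
  assumes "finite S" "a \<in> S" "b \<in> S" "a \<noteq> b"
    and "\<And>x. x \<in> S \<Longrightarrow> orient a b x \<ge> 0" "orient a v b \<ge> 0"
  shows "area (convex hull S) + orient a v b / 2 \<le> area (convex hull (insert v S))"
proof -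
  let ?T = "{a, v, b}"
  have "area (convex hull S) + orient a v b / 2 = area (convex hull S) + area (convex hull ?T)"
    using assms(6) by (simp add: area_triangle)
  also have "\<dots> = area (convex hull S \<union> convex hull ?T)"
    using assms by (subst area_hull_Un[of S ?T a b]) (auto simp: orient_swap[of a v b])
  also have "\<dots> \<le> area (convex hull (insert v S))"
  proof (rule measure_mono_fmeasurable)
    show "convex hull S \<union> convex hull ?T \<subseteq> convex hull (insert v S)"
      using assms(2,3) by (intro Un_least hull_mono) auto
    show "convex hull S \<union> convex hull ?T \<in> sets lebesgue"
      using assms(1) by (intro fmeasurableD fmeasurable.Un hull_lmeasurable) auto
  qed (simp add: hull_lmeasurable assms(1))
  finally show ?thesis .
qed

lemma in_triangle:
  assumes "x - v = s *\<^sub>R (a - v) + t *\<^sub>R (b - v)" "0 \<le> s" "0 \<le> t" "s + t \<le> 1"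
  shows "x \<in> convex hull {a, v, b}"
proof -
  have "x = s *\<^sub>R a + (1 - s - t) *\<^sub>R v + t *\<^sub>R b"
    using assms(1) unfolding diff_eq_eq by (simp add: algebra_simps)
  then show ?thesis
    unfolding convex_hull_3 using assms by force
qed

text \<open>Cramer's rule for the coordinates of \<open>y - v\<close> in the basis \<open>a - v\<close>, \<open>b - v\<close>.\<close>
lemma triangle_coordinates:
  assumes "orient a v b \<noteq> 0"
  shows "y - v = (orient v b y / orient a v b) *\<^sub>R (a - v) + (orient v y a / orient a v b) *\<^sub>R (b - v)"
proof -
  have "orient a v b *\<^sub>R (y - v) = orient v b y *\<^sub>R (a - v) + orient v y a *\<^sub>R (b - v)"
    by (simp add: vec_eq_iff forall_2 orient_expand algebra_simps)
  then have "inverse (orient a v b) *\<^sub>R (orient a v b *\<^sub>R (y - v)) =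
      inverse (orient a v b) *\<^sub>R (orient v b y *\<^sub>R (a - v) + orient v y a *\<^sub>R (b - v))"
    by (rule arg_cong)
  then show ?thesis
    using assms by (simp add: scaleR_add_right divide_inverse mult.commute)
qed

lemma orient_sum: "orient v b y + orient v y a = orient a v b + orient a b y"
  by (simp add: orient_expand algebra_simps)

text \<open>Seen from \<open>v\<close>, the set \<open>S\<close> lies in the angle spanned by \<open>a\<close> and \<open>b\<close> and beyond the line \<open>ab\<close>. A
segment from \<open>v\<close> into the hull of \<open>S\<close> therefore leaves the triangle through its side \<open>ab\<close>, which
already belongs to that hull.\<close>
lemma hull_split:
  assumes "a \<in> S" "b \<in> S" "orient a v b > 0"
    and S: "\<And>x. x \<in> S \<Longrightarrow> orient v b x \<ge> 0" "\<And>x. x \<in> S \<Longrightarrow> orient a v x \<ge> 0"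
      "\<And>x. x \<in> S \<Longrightarrow> orient a b x \<ge> 0"
  shows "convex hull (insert v S) = convex hull S \<union> convex hull {a, v, b}"
proof
  show "convex hull S \<union> convex hull {a, v, b} \<subseteq> convex hull (insert v S)"
    using assms(1,2) by (intro Un_least hull_mono) auto
  show "convex hull (insert v S) \<subseteq> convex hull S \<union> convex hull {a, v, b}"
  proof
    fix x assume "x \<in> convex hull (insert v S)"
    moreover have "S \<noteq> {}" using assms(1) by auto
    ultimately obtain p t y where pt: "0 \<le> p" "0 \<le> t" "p + t = 1" and y: "y \<in> convex hull S"
      and x: "x = p *\<^sub>R v + t *\<^sub>R y"
      unfolding convex_hull_insert[OF \<open>S \<noteq> {}\<close>] by auto
    have p: "p = 1 - t" using pt by simp
    define K \<alpha> \<beta> where "K = orient a v b" and "\<alpha> = orient v b y / K" and "\<beta> = orient v y a / K"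
    have K: "K > 0" using assms(3) by (simp add: K_def)
    have or: "orient v b y \<ge> 0" "orient a v y \<ge> 0" "orient a b y \<ge> 0"
      using orient_hull(1)[OF y] S by auto
    have nn: "\<alpha> \<ge> 0" "\<beta> \<ge> 0"
      using or K orient_rotate[of v y a] by (auto simp: \<alpha>_def \<beta>_def)
    have yv: "y - v = \<alpha> *\<^sub>R (a - v) + \<beta> *\<^sub>R (b - v)"
      using triangle_coordinates[of a v b y] K by (simp add: \<alpha>_def \<beta>_def K_def)
    have "\<alpha> + \<beta> = (K + orient a b y) / K"
      unfolding \<alpha>_def \<beta>_def K_def using orient_sum[of v b y a] by (simp add: add_divide_distrib[symmetric])
    moreover have "1 \<le> (K + orient a b y) / K" using K or(3) by simp
    ultimately have ge1: "\<alpha> + \<beta> \<ge> 1" by simp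
    have xv: "x - v = t *\<^sub>R (y - v)" by (simp add: x p algebra_simps)
    show "x \<in> convex hull S \<union> convex hull {a, v, b}"
    proof (cases "t * (\<alpha> + \<beta>) \<le> 1")
      case True
      have "x - v = (t * \<alpha>) *\<^sub>R (a - v) + (t * \<beta>) *\<^sub>R (b - v)"
        unfolding xv yv by (simp add: scaleR_add_right)
      then have "x \<in> convex hull {a, v, b}"
        using True nn pt by (intro in_triangle) (auto simp: distrib_left)
      then show ?thesis by simp
    next
      case False
      \<comment> \<open>the segment from \<open>v\<close> to \<open>y\<close> crosses the side \<open>ab\<close> at \<open>z\<close>, before reaching \<open>x\<close>\<close>
      define s where "s = 1 / (\<alpha> + \<beta>)"
      define z where "z = v + s *\<^sub>R (y - v)"
      have s: "0 < s" "s \<le> 1" "s < t"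
        using ge1 False pt by (auto simp: s_def field_simps)
      have "s * \<alpha> + s * \<beta> = 1" using ge1 by (simp add: s_def add_divide_distrib[symmetric])
      then have "z = (s * \<alpha>) *\<^sub>R a + (s * \<beta>) *\<^sub>R b"
        unfolding z_def yv vec_eq_iff by (intro allI, simp) algebra
      then have zS: "z \<in> convex hull S"
        using convexD[OF convex_convex_hull hull_inc[OF assms(1)] hull_inc[OF assms(2)]] nn s
          \<open>s * \<alpha> + s * \<beta> = 1\<close> by simp
      have "s \<noteq> 1" using s pt by auto
      define r where "r = (t - s) / (1 - s)"
      have r: "0 \<le> r" "r \<le> 1" using s pt \<open>s \<noteq> 1\<close> by (auto simp: r_def field_simps)
      have "t = (1 - r) * s + r" using \<open>s \<noteq> 1\<close> by (simp add: r_def divide_simps) algebra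
      then have "x = v + ((1 - r) * s + r) *\<^sub>R (y - v)"
        using xv by (simp add: diff_eq_eq add.commute)
      also have "\<dots> = (1 - r) *\<^sub>R z + r *\<^sub>R y"
        by (simp add: z_def algebra_simps)
      finally have "x = (1 - r) *\<^sub>R z + r *\<^sub>R y" .
      then have "x \<in> convex hull S"
        using zS y r by (simp add: convexD)
      then show ?thesis by simp
    qed
  qed
qed

lemma area_split:
  assumes "finite S" "a \<in> S" "b \<in> S" "orient a v b > 0"
    and S: "\<And>x. x \<in> S \<Longrightarrow> orient v b x \<ge> 0" "\<And>x. x \<in> S \<Longrightarrow> orient a v x \<ge> 0"
      "\<And>x. x \<in> S \<Longrightarrow> orient a b x \<ge> 0"
  shows "area (convex hull (insert v S)) = area (convex hull S) + orient a v b / 2"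
proof -
  have "a \<noteq> b" using assms(4) by auto
  have "area (convex hull (insert v S)) = area (convex hull S \<union> convex hull {a, v, b})"
    using hull_split[OF assms(2-)] by simp
  also have "\<dots> = area (convex hull S) + area (convex hull {a, v, b})"
    using assms \<open>a \<noteq> b\<close> by (subst area_hull_Un[of S _ a b]) (auto simp: orient_swap[of a v b])
  finally show ?thesis using assms(4) by (simp add: area_triangle)
qed

text \<open>The parameters are given by Cramer's rule; their common denominator is twice the area of the
quadrilateral, which is the sum of two triangles in two ways.\<close>
lemma quadrilateral_diagonals_cross:
  assumes "orient a b c > 0" "orient a c d > 0" "orient a b d > 0" "orient b c d > 0"
  obtains s t where "0 < s" "s < 1" "0 < t" "t < 1"
    "a + s *\<^sub>R (c - a) = b + t *\<^sub>R (d - b)"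
proof
  let ?W = "orient a b c + orient a c d"
  have W: "?W = orient a b d + orient b c d" by (simp add: orient_expand algebra_simps)
  have "?W > 0" using assms by simp
  show "0 < orient a b d / ?W" "orient a b d / ?W < 1"
    using assms W by (auto simp: divide_simps)
  show "0 < orient a b c / ?W" "orient a b c / ?W < 1"
    using assms by (auto simp: divide_simps)
  have "?W *\<^sub>R (a - b) + orient a b d *\<^sub>R (c - a) = orient a b c *\<^sub>R (d - b)"
    by (simp add: vec_eq_iff forall_2 orient_expand algebra_simps)
  then have "inverse ?W *\<^sub>R (?W *\<^sub>R (a - b) + orient a b d *\<^sub>R (c - a)) =
      inverse ?W *\<^sub>R (orient a b c *\<^sub>R (d - b))"
    by (rule arg_cong)
  then have "a - b + (orient a b d / ?W) *\<^sub>R (c - a) = (orient a b c / ?W) *\<^sub>R (d - b)"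
    using \<open>?W > 0\<close> by (simp add: scaleR_add_right[of "inverse ?W"] divide_inverse mult.commute)
  then show "a + (orient a b d / ?W) *\<^sub>R (c - a) = b + (orient a b c / ?W) *\<^sub>R (d - b)"
    by (simp add: algebra_simps)
qed

section \<open>Convex polygons as periodic sequences\<close>

text \<open>Periodicity turns a rotation of the vertices into a shift of the index. Asking all triples, not
just consecutive ones, to turn left excludes curves that wind around several times, and it makes
the property pass to subsequences. The bound on \<open>k\<close> keeps a triple within one period.\<close>
definition convex_cycle :: "nat \<Rightarrow> (nat \<Rightarrow> real^2) \<Rightarrow> bool" where
  "convex_cycle n C \<longleftrightarrow> (\<forall>i. C (i + n) = C i) \<and>
     (\<forall>i j k. i < j \<and> j < k \<and> k < i + n \<longrightarrow> orient (C i) (C j) (C k) > 0)"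

abbreviation verts :: "nat \<Rightarrow> (nat \<Rightarrow> real^2) \<Rightarrow> (real^2) set" where
  "verts n C \<equiv> C ` {..<n}"

text \<open>Twice the area of the ear at \<open>C (i + 1)\<close>; naming an ear by its first vertex avoids a predecessor
of the index \<open>0\<close>.\<close>
abbreviation ear :: "(nat \<Rightarrow> real^2) \<Rightarrow> nat \<Rightarrow> real" where
  "ear C i \<equiv> orient (C i) (C (i + 1)) (C (i + 2))"

definition shoelace :: "nat \<Rightarrow> (nat \<Rightarrow> real^2) \<Rightarrow> real" where
  "shoelace n C = (\<Sum>i<n. wedge (C i) (C (i + 1)))"

lemma cycle_period: "convex_cycle n C \<Longrightarrow> C (i + n) = C i"
  by (simp add: convex_cycle_def)

lemma cycle_orient: "convex_cycle n C \<Longrightarrow> i < j \<Longrightarrow> j < k \<Longrightarrow> k < i + n \<Longrightarrow> orient (C i) (C j) (C k) > 0"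
  by (simp add: convex_cycle_def)

lemma cycle_periods: assumes "convex_cycle n C" shows "C (i + q * n) = C i"
proof (induction q)
  case (Suc q)
  have "C (i + Suc q * n) = C ((i + q * n) + n)" by (simp add: algebra_simps)
  then show ?case using Suc cycle_period[OF assms] by metis
qed simp

lemma cycle_mod: assumes "convex_cycle n C" shows "C (i mod n) = C i"
  using cycle_periods[OF assms, of "i mod n" "i div n"] by simp

lemma verts_range: assumes "convex_cycle n C" "n > 0" shows "verts n C = range C"
proof
  show "range C \<subseteq> verts n C"
    using cycle_mod[OF assms(1)] assms(2) by (metis image_subset_iff imageI lessThan_iff mod_less_divisor)
qed auto

lemma cycle_shift: assumes "convex_cycle n C" shows "convex_cycle n (\<lambda>i. C (i + r))"
  unfolding convex_cycle_def
proof (intro conjI allI impI)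
  show "C (i + n + r) = C (i + r)" for i
    using cycle_period[OF assms, of "i + r"] by (simp add: add_ac)
  show "orient (C (i + r)) (C (j + r)) (C (k + r)) > 0" if "i < j \<and> j < k \<and> k < i + n" for i j k
    using that by (intro cycle_orient[OF assms]) auto
qed

lemma range_shift: assumes "convex_cycle n C" "n > 0" shows "range (\<lambda>i. C (i + r)) = range C"
proof -
  have "C i = C ((i + r * n - r) + r)" for i
  proof -
    have "r \<le> r * n" using assms(2) by simp
    then have "i + r * n - r + r = i + r * n" by linarith
    then show ?thesis using cycle_periods[OF assms(1)] by simp
  qed
  then show ?thesis by (auto intro!: image_eqI)
qed

lemma cycle_window:
  assumes "convex_cycle n C" "n \<ge> 3"
  shows "range C = C ` {i + 1..<i + 1 + n}"
proof -
  have "range C = verts n (\<lambda>j. C (j + (i + 1)))"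
    using verts_range[OF cycle_shift[OF assms(1), of "i + 1"]] range_shift[OF assms(1), of "i + 1"] assms(2)
    by auto
  also have "\<dots> = C ` ((\<lambda>j. j + (i + 1)) ` {..<n})" by (simp add: image_image)
  also have "(\<lambda>j. j + (i + 1)) ` {..<n} = {i + 1..<i + 1 + n}"
    by (metis add.commute image_add_atLeastLessThan' lessThan_atLeast0 add_0)
  finally show ?thesis .
qed

lemma cycle_inj:
  assumes "convex_cycle n C" "n \<ge> 3" "i < j" "j < i + n"
  shows "C i \<noteq> C j"
proof (cases "j = i + 1")
  case True
  then show ?thesis using cycle_orient[OF assms(1), of i j "j + 1"] assms(2) by auto
next
  case False
  then show ?thesis using cycle_orient[OF assms(1), of i "i + 1" j] assms by auto
qed

lemma card_verts: assumes "convex_cycle n C" "n \<ge> 3" shows "card (verts n C) = n"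
proof -
  have "inj_on C {..<n}"
    using cycle_inj[OF assms] by (intro inj_onI) (metis lessThan_iff linorder_neqE_nat trans_less_add2)
  then show ?thesis by (simp add: card_image)
qed

lemma cycle_others:
  assumes "convex_cycle n C" "n \<ge> 3" "q \<in> range C - {C (i + 1)}"
  obtains "q = C i" | "q = C (i + 2)" | k where "i + 2 < k" "k < i + n" "q = C k"
proof -
  obtain k where k: "q = C k" "i + 1 \<le> k" "k < i + 1 + n"
    using assms(3) cycle_window[OF assms(1,2), of i] by auto
  then have "k \<noteq> i + 1" using assms(3) by auto
  then consider "k = i + 2" | "k = i + n" | "i + 2 < k" "k < i + n" using k by linarith
  then show ?thesis using that k cycle_period[OF assms(1), of i] by metis
qed

text \<open>All other vertices lie in the angle of the polygon at \<open>C (i + 1)\<close> and beyond the base of its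
ear. This is what allows the ear to be cut off.\<close>
lemma ear_sides:
  assumes "convex_cycle n C" "n \<ge> 3" "q \<in> range C - {C (i + 1)}"
  shows "orient (C (i + 1)) (C (i + 2)) q \<ge> 0" "orient (C i) (C (i + 1)) q \<ge> 0"
    "orient (C i) (C (i + 2)) q \<ge> 0"
proof -
  note o = cycle_orient[OF assms(1)]
  have e: "ear C i > 0" using o assms(2) by simp
  have "orient (C (i + 1)) (C (i + 2)) q \<ge> 0 \<and> orient (C i) (C (i + 1)) q \<ge> 0 \<and>
    orient (C i) (C (i + 2)) q \<ge> 0"
    using assms
  proof (cases rule: cycle_others)
    case 1
    then show ?thesis using e orient_rotate[of "C (i + 1)" "C (i + 2)" "C i"] by simp
  next
    case 2
    then show ?thesis using e by simp
  next
    case (3 k)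
    then show ?thesis using o[of "i + 1" "i + 2" k] o[of i "i + 1" k] o[of i "i + 2" k] by simp
  qed
  then show "orient (C (i + 1)) (C (i + 2)) q \<ge> 0" "orient (C i) (C (i + 1)) q \<ge> 0"
    "orient (C i) (C (i + 2)) q \<ge> 0" by auto
qed

lemma cycle_Suc_surj:
  assumes "convex_cycle n C" "n > 0" "v \<in> range C"
  obtains i where "v = C (i + 1)"
proof -
  have "v \<in> range (\<lambda>i. C (i + 1))" using assms range_shift by blast
  then show ?thesis using that by auto
qed

lemma cycle_ends_in:
  assumes "convex_cycle n C" "n \<ge> 3"
  shows "C i \<in> range C - {C (i + 1)}" "C (i + 2) \<in> range C - {C (i + 1)}"
  using cycle_inj[OF assms, of i "i + 1"] cycle_inj[OF assms, of "i + 1" "i + 2"] assms(2) by auto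

lemma finite_range_cycle: "convex_cycle n C \<Longrightarrow> n \<ge> 3 \<Longrightarrow> finite (range C)"
  using verts_range[of n C] by (metis finite_imageI finite_lessThan gr0I not_numeral_le_zero)

lemma cycle_independent:
  assumes "convex_cycle n C" "n \<ge> 3" "v \<in> range C"
  shows "v \<notin> convex hull (range C - {v})"
proof
  assume h: "v \<in> convex hull (range C - {v})"
  obtain i where v: "v = C (i + 1)" using cycle_Suc_surj assms by (metis gr0I not_numeral_le_zero)
  have "orient (C i) (C (i + 2)) v \<ge> 0"
    using orient_hull(1)[OF h] ear_sides(3)[OF assms(1,2)] v by blast
  moreover have "ear C i > 0" using cycle_orient[OF assms(1), of i "i + 1" "i + 2"] assms(2) by simp
  ultimately show False using orient_swap[of "C i" v "C (i + 2)"] v by simp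
qed

lemma cycle_area_split:
  assumes "convex_cycle n C" "n \<ge> 3"
  shows "area (convex hull (range C)) = area (convex hull (range C - {C (i + 1)})) + ear C i / 2"
proof -
  have "area (convex hull (insert (C (i + 1)) (range C - {C (i + 1)}))) =
      area (convex hull (range C - {C (i + 1)})) + ear C i / 2"
  proof (rule area_split)
    show "finite (range C - {C (i + 1)})" using finite_range_cycle[OF assms] by simp
    show "C i \<in> range C - {C (i + 1)}" "C (i + 2) \<in> range C - {C (i + 1)}"
      using cycle_ends_in[OF assms] by auto
    show "ear C i > 0" using cycle_orient[OF assms(1), of i "i + 1" "i + 2"] assms(2) by simp
  qed (use ear_sides[OF assms] in auto)
  then show ?thesis by (simp add: insert_absorb)
qed

text \<open>Subpolygons are obtained by strictly increasing reindexings compatible with the two periods.\<close>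
lemma cycle_reindex:
  assumes "convex_cycle n C" and \<sigma>: "strict_mono \<sigma>" "\<And>i. \<sigma> (i + m) = \<sigma> i + n"
  shows "convex_cycle m (C \<circ> \<sigma>)"
  unfolding convex_cycle_def
proof (intro conjI allI impI)
  show "(C \<circ> \<sigma>) (i + m) = (C \<circ> \<sigma>) i" for i
    using cycle_period[OF assms(1)] \<sigma>(2) by simp
  fix i j k assume a: "i < j \<and> j < k \<and> k < i + m"
  then have "\<sigma> k < \<sigma> (i + m)" using \<sigma>(1) strict_monoD by blast
  then show "orient ((C \<circ> \<sigma>) i) ((C \<circ> \<sigma>) j) ((C \<circ> \<sigma>) k) > 0"
    using a \<sigma> strict_monoD[OF \<sigma>(1)] by (auto intro!: cycle_orient[OF assms(1)])
qed

text \<open>A triple of indices within one period reduces modulo \<open>n\<close> to a cyclic rotation of an increasing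
triple.\<close>
lemma cycle_of_order:
  assumes "\<And>i j k. i < j \<Longrightarrow> j < k \<Longrightarrow> k < n \<Longrightarrow> orient (A i) (A j) (A k) > 0"
  shows "convex_cycle n (\<lambda>i. A (i mod n))"
  unfolding convex_cycle_def
proof (intro conjI allI impI)
  fix i j k assume ijk: "i < j \<and> j < k \<and> k < i + n"
  then have n: "n > 0" by auto
  define r d where "r = i mod n" and "d = i div n * n"
  have i: "i = r + d" "r < n" using n by (simp_all add: r_def d_def)
  define j' k' where "j' = j - d" and "k' = k - d"
  have jk: "j = j' + d" "k = k' + d" "r < j'" "j' < k'" "k' < r + n"
    using ijk i by (auto simp: j'_def k'_def)
  have md: "(x + d) mod n = x mod n" for x by (simp add: d_def)
  have m: "i mod n = r" "j mod n = j' mod n" "k mod n = k' mod n"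
    using i jk md by simp_all
  consider "k' < n" | "j' < n" "k' \<ge> n" | "j' \<ge> n" by linarith
  then show "orient (A (i mod n)) (A (j mod n)) (A (k mod n)) > 0"
  proof cases
    case 1
    then show ?thesis using m jk assms[of r j' k'] by simp
  next
    case 2
    then have "k' mod n = k' - n" "k' - n < r" using jk i by (auto simp: mod_if)
    then show ?thesis using m jk 2 assms[of "k' - n" r j'] orient_rotate[of "A r" "A j'" "A (k' - n)"] by simp
  next
    case 3
    then have "k' mod n = k' - n" "j' mod n = j' - n" "k' - n < r" using jk i by (auto simp: mod_if)
    then show ?thesis using m jk 3 i assms[of "j' - n" "k' - n" r]
        orient_rotate[of "A (j' - n)" "A (k' - n)" "A r"] by (simp add: orient_rotate)
  qed
qed simp

section \<open>Every convex polygon is a periodic sequence\<close>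

text \<open>Here \<open>b\<close> lies in the angle \<open>apc\<close> but not beyond the line \<open>ac\<close>. With the first vertex \<open>p\<close> of a
polygon and the others sorted by angle around \<open>p\<close>, this shows that any three of them turn left
as well.\<close>
lemma between_in_triangle:
  assumes "orient p a c > 0" "orient p a b > 0" "orient p b c > 0" "orient a b c \<le> 0"
  shows "b \<in> convex hull {a, p, c}"
proof (rule in_triangle)
  have K: "orient a p c < 0" using assms(1) by (simp add: orient_expand algebra_simps)
  show "b - p = (orient p c b / orient a p c) *\<^sub>R (a - p) + (orient p b a / orient a p c) *\<^sub>R (c - p)"
    using triangle_coordinates K by simp
  show "0 \<le> orient p c b / orient a p c" "0 \<le> orient p b a / orient a p c"
    using K assms(2,3) orient_swap[of p c b] orient_swap[of p b a] by (simp_all add: divide_le_0_iff)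
  have "orient a c b \<ge> 0" using assms(4) by (simp add: orient_swap[of a c b])
  then have "orient p c b + orient p b a \<ge> orient a p c"
    using orient_sum[of p c b a] by simp
  then show "orient p c b / orient a p c + orient p b a / orient a p c \<le> 1"
    using K by (simp add: add_divide_distrib[symmetric] divide_le_eq_1)
qed

lemma sorted_enumeration:
  fixes t :: "'a \<Rightarrow> real"
  assumes "finite S" "inj_on t S"
  obtains f where "f ` {..<card S} = S" "\<And>i j. i < j \<Longrightarrow> j < card S \<Longrightarrow> t (f i) < t (f j)"
proof -
  define l where "l = sorted_list_of_set (t ` S)"
  have l: "set l = t ` S" "sorted_wrt (<) l" "length l = card S"
    using assms by (simp_all add: l_def card_image)
  define f where "f i = inv_into S t (l ! i)" for i
  have tf: "t (f i) = l ! i" if "i < card S" for i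
    using that l by (metis f_def f_inv_into_f nth_mem)
  have "f ` {..<card S} = inv_into S t ` set l"
    by (auto simp: f_def set_conv_nth l(3))
  also have "\<dots> = S" using l(1) assms(2) by (simp add: inv_into_image_cancel)
  finally have "f ` {..<card S} = S" .
  moreover have "t (f i) < t (f j)" if "i < j" "j < card S" for i j
    using that tf l(2,3) by (simp add: sorted_wrt_nth_less)
  ultimately show ?thesis using that by blast
qed

text \<open>The points are sorted by angle around one of them, \<open>p\<close>. As \<open>p\<close> is separated from the rest by a
line with some normal \<open>w\<close>, all directions from \<open>p\<close> make an acute angle with \<open>w\<close> and can be
compared by the tangent \<open>t\<close> of that angle (up to the factor \<open>norm w\<close>). Two points in the same
direction, or three points turning the wrong way, would put one of the points into the hull of
others.\<close>
lemma exists_cycle: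
  fixes V :: "(real^2) set"
  assumes "finite V" "card V = n" "n \<ge> 3" and ind: "\<And>v. v \<in> V \<Longrightarrow> v \<notin> convex hull (V - {v})"
  obtains C where "convex_cycle n C" "range C = V"
proof -
  obtain p where p: "p \<in> V" using assms(2,3) by fastforce
  define S where "S = V - {p}"
  have finS: "finite S" and cardS: "card S = n - 1" using assms p by (auto simp: S_def)
  obtain w c where wc: "w \<bullet> p < c" "\<forall>x\<in>convex hull S. w \<bullet> x > c"
    using separating_hyperplane_closed_point[of "convex hull S" p] ind[OF p] finS
      finite_imp_compact_convex_hull[OF finS] compact_imp_closed by (auto simp: S_def)
  define h where "h x = w \<bullet> (x - p)" for x
  have h: "h x > 0" if "x \<in> S" for x
    using wc hull_inc[OF that, of convex] by (fastforce simp: h_def inner_diff_right)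
  define t where "t x = wedge w (x - p) / h x" for x
  have "S \<noteq> {}" using cardS assms(3) by auto
  then obtain x\<^sub>0 where "x\<^sub>0 \<in> S" by blast
  then have "w \<noteq> 0" using h[of x\<^sub>0] by (auto simp: h_def)
  then have w0: "w \<bullet> w > 0" by simp
  have key: "(w \<bullet> w) * orient p x y = h x * wedge w (y - p) - wedge w (x - p) * h y" for x y
    by (simp add: orient_expand h_def inner_vec_def sum_2 algebra_simps)
  have tless: "t x < t y \<longleftrightarrow> orient p x y > 0" if "x \<in> S" "y \<in> S" for x y
  proof -
    have "t x < t y \<longleftrightarrow> wedge w (x - p) * h y < wedge w (y - p) * h x"
      using h that by (simp add: t_def frac_less_eq mult_neg_pos divide_less_eq less_divide_eq field_simps)
    also have "\<dots> \<longleftrightarrow> (w \<bullet> w) * orient p x y > 0" by (simp add: key mult.commute)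
    also have "\<dots> \<longleftrightarrow> orient p x y > 0" 
      using mult_less_cancel_left_pos[OF w0, of 0 "orient p x y"] by (simp only: mult_zero_right)
    finally show ?thesis .
  qed
  have notin: "x \<notin> convex hull {a, p, b}" if "x \<in> S" "a \<in> S" "b \<in> S" "x \<noteq> a" "x \<noteq> b" for x a b
  proof -
    have "convex hull {a, p, b} \<subseteq> convex hull (V - {x})"
      using that p by (intro hull_mono) (auto simp: S_def)
    then show ?thesis using ind[of x] that by (auto simp: S_def)
  qed
  have "inj_on t S"
  proof (rule inj_onI, rule ccontr)
    fix x y assume xy: "x \<in> S" "y \<in> S" "t x = t y" "x \<noteq> y"
    have *: False if "x \<in> S" "y \<in> S" "t x = t y" "x \<noteq> y" "h x \<le> h y" for x y
    proof -
      have hp: "h x > 0" "h y > 0" using h that by auto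
      have eq: "h x * wedge w (y - p) = wedge w (x - p) * h y"
        using that(3) hp by (simp add: t_def field_simps)
      then have "orient p x y = 0" using key[of x y] w0 by simp
      moreover have "h y *\<^sub>R (x - p) - h x *\<^sub>R (y - p) = orient p x y *\<^sub>R vector [w$2, - w$1]"
        by (simp add: vec_eq_iff forall_2 orient_expand h_def inner_vec_def sum_2 algebra_simps)
      ultimately have "h y *\<^sub>R (x - p) = h x *\<^sub>R (y - p)" by simp
      then have "inverse (h y) *\<^sub>R (h y *\<^sub>R (x - p)) = inverse (h y) *\<^sub>R (h x *\<^sub>R (y - p))" by simp
      then have "x - p = (h x / h y) *\<^sub>R (y - p) + 0 *\<^sub>R (y - p)" using hp
        by (simp add: divide_inverse mult.commute)
      then have "x \<in> convex hull {y, p, y}"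
        by (rule in_triangle) (use hp that in auto)
      then show False using notin that by blast
    qed
    show False using *[of x y] *[of y x] xy by (cases "h x \<le> h y") auto
  qed
  then obtain f where f: "f ` {..<card S} = S" "\<And>i j. i < j \<Longrightarrow> j < card S \<Longrightarrow> t (f i) < t (f j)"
    using sorted_enumeration finS by blast
  define A where "A i = (if i = 0 then p else f (i - 1))" for i
  have AS: "A i \<in> S" if "0 < i" "i < n" for i
    using that f(1) cardS by (auto simp: A_def)
  have At: "t (A i) < t (A j)" if "0 < i" "i < j" "j < n" for i j
    using that f(2)[of "i - 1" "j - 1"] cardS by (auto simp: A_def)
  have Ap: "orient p (A i) (A j) > 0" if "0 < i" "i < j" "j < n" for i j
    using that At AS tless by auto
  have "orient (A i) (A j) (A k) > 0" if ijk: "i < j" "j < k" "k < n" for i j k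
  proof (cases "i = 0")
    case True
    then show ?thesis using Ap[of j k] ijk by (simp add: A_def)
  next
    case False
    show ?thesis
    proof (rule ccontr)
      assume "\<not> ?thesis"
      then have "A j \<in> convex hull {A i, p, A k}"
        using False ijk by (intro between_in_triangle Ap) auto
      moreover have "A j \<noteq> A i" "A j \<noteq> A k" using At[of i j] At[of j k] ijk False by auto
      ultimately show False using notin AS False ijk by auto
    qed
  qed
  then have C: "convex_cycle n (\<lambda>i. A (i mod n))" by (rule cycle_of_order)
  have "{..<n} = insert 0 (Suc ` {..<card S})"
    using cardS assms(3) lessThan_Suc_eq_insert_0[of "card S"] by simp
  then have "A ` {..<n} = insert (A 0) ((\<lambda>i. A (Suc i)) ` {..<card S})"
    by (simp only: image_insert image_image)
  also have "\<dots> = insert p (f ` {..<card S})" by (simp add: A_def)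
  also have "\<dots> = V" using f(1) p by (auto simp: S_def)
  finally have "verts n (\<lambda>i. A (i mod n)) = V" by simp
  then have "range (\<lambda>i. A (i mod n)) = V" using verts_range[OF C] assms(3) by simp
  then show ?thesis using that C by blast
qed

section \<open>The smallest ear of a hexagon\<close>

lemma orient_wedge: "orient a b c = wedge a b + wedge b c + wedge c a"
  by (simp add: orient_expand algebra_simps)

lemma orient_collinear [simp]: "orient (a + r *\<^sub>R u) (a + s *\<^sub>R u) (a + t *\<^sub>R u) = 0"
  by (simp add: orient_expand algebra_simps)

text \<open>The area of a triangle with fixed base is affine in its apex, hence bounded below on a segment
by its values at the ends.\<close>
lemma orient_ge_on_segment:
  assumes "m \<le> orient a b p" "m \<le> orient a b q" "0 < t" "t < 1"
  shows "m \<le> orient a b (p + t *\<^sub>R (q - p))"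
proof -
  have "orient a b (p + t *\<^sub>R (q - p)) = (1 - t) * orient a b p + t * orient a b q"
    by (simp add: orient_expand algebra_simps)
  moreover have "(1 - t) * m \<le> (1 - t) * orient a b p" "t * m \<le> t * orient a b q"
    using assms by (auto intro: mult_left_mono)
  ultimately show ?thesis by (simp add: algebra_simps)
qed

text \<open>The wedge of the diagonals is twice the area of the quadrilateral \<open>abcd\<close>.\<close>
lemma wedge_diagonals: "wedge (c - a) (d - b) = orient a b c + orient a c d"
  by (simp add: orient_expand algebra_simps)

text \<open>Let the main diagonals be \<open>A0 A3\<close>, \<open>A1 A4\<close>, \<open>A2 A5\<close>, with \<open>X\<close> the intersection of the first two,
\<open>Y\<close> that of the first and third, \<open>Z\<close> that of the last two. The triangles \<open>A0 A1 Y\<close>, \<open>A1 A2 Y\<close>,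
\<open>A2 A3 Z\<close>, \<open>A3 A4 Z\<close>, \<open>A4 A5 X\<close>, \<open>A5 A0 X\<close> have signed areas that add up to the hexagon minus
the triangle \<open>X Y Z\<close>: the remaining polygon \<open>A0 Y A2 Z A4 X\<close> has the points \<open>A0\<close>, \<open>A2\<close>, \<open>A4\<close> on
the lines through the sides of \<open>X Y Z\<close>. The triangle \<open>X Y Z\<close> is never negatively oriented,
whichever way the diagonals pass each other, as its sides are multiples of the diagonals, and
passing from one case to the other reverses all three of them.\<close>
lemma hexagon_ear_bound:
  assumes "convex_cycle 6 C" and e: "\<And>i. m \<le> ear C i"
  shows "6 * m \<le> shoelace 6 C"
proof -
  have C6: "C 6 = C 0" "C 7 = C 1"
    using cycle_period[OF assms(1), of 0] cycle_period[OF assms(1), of 1] by simp_all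
  note o = cycle_orient[OF assms(1)]
  define A0 A1 A2 A3 A4 A5 where "A0 = C 0" "A1 = C 1" "A2 = C 2" "A3 = C 3" "A4 = C 4" "A5 = C 5"
  note A = this
  have ears: "m \<le> orient A0 A1 A2" "m \<le> orient A1 A2 A3" "m \<le> orient A2 A3 A4"
    "m \<le> orient A3 A4 A5" "m \<le> orient A4 A5 A0" "m \<le> orient A5 A0 A1"
    using e[of 0] e[of 1] e[of 2] e[of 3] e[of 4] e[of 5] C6 by (simp_all add: A numeral_2_eq_2[symmetric])
  have pos: "orient A0 A1 A3 > 0" "orient A0 A3 A4 > 0" "orient A0 A1 A4 > 0" "orient A1 A3 A4 > 0"
    "orient A0 A2 A3 > 0" "orient A0 A3 A5 > 0" "orient A0 A2 A5 > 0" "orient A2 A3 A5 > 0"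
    "orient A1 A2 A4 > 0" "orient A1 A4 A5 > 0" "orient A1 A2 A5 > 0" "orient A2 A4 A5 > 0"
    unfolding A by (rule o; simp)+
  \<comment> \<open>the pairwise intersections of the three main diagonals\<close>
  obtain s t where st: "0 < s" "s < 1" "0 < t" "t < 1" "A0 + s *\<^sub>R (A3 - A0) = A1 + t *\<^sub>R (A4 - A1)"
    by (rule quadrilateral_diagonals_cross[OF pos(1-4)])
  obtain s' q where sq: "0 < s'" "s' < 1" "0 < q" "q < 1" "A0 + s' *\<^sub>R (A3 - A0) = A2 + q *\<^sub>R (A5 - A2)"
    by (rule quadrilateral_diagonals_cross[OF pos(5-8)])
  obtain t' q' where tq: "0 < t'" "t' < 1" "0 < q'" "q' < 1" "A1 + t' *\<^sub>R (A4 - A1) = A2 + q' *\<^sub>R (A5 - A2)"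
    by (rule quadrilateral_diagonals_cross[OF pos(9-12)])
  define X Y Z where "X = A0 + s *\<^sub>R (A3 - A0)" and "Y = A0 + s' *\<^sub>R (A3 - A0)"
    and "Z = A1 + t' *\<^sub>R (A4 - A1)"
  have X': "X = A1 + t *\<^sub>R (A4 - A1)" and Y': "Y = A2 + q *\<^sub>R (A5 - A2)" and Z': "Z = A2 + q' *\<^sub>R (A5 - A2)"
    using st(5) sq(5) tq(5) by (simp_all add: X_def Y_def Z_def)
  \<comment> \<open>each triangle over a side has its apex on a diagonal whose two ends form ears with that side\<close>
  have "m \<le> orient A0 A1 Y" unfolding Y' using ears sq
    by (intro orient_ge_on_segment) (simp_all add: orient_rotate[of A0 A1 A5])
  moreover have "m \<le> orient A1 A2 Y" unfolding Y_def using ears sq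
    by (intro orient_ge_on_segment) (simp_all add: orient_rotate[of A1 A2 A0])
  moreover have "m \<le> orient A2 A3 Z" unfolding Z_def using ears tq
    by (intro orient_ge_on_segment) (simp_all add: orient_rotate[of A2 A3 A1])
  moreover have "m \<le> orient A3 A4 Z" unfolding Z' using ears tq
    by (intro orient_ge_on_segment) (simp_all add: orient_rotate[of A3 A4 A2])
  moreover have "m \<le> orient A4 A5 X" unfolding X_def using ears st
    by (intro orient_ge_on_segment) (simp_all add: orient_rotate[of A4 A5 A3])
  moreover have "m \<le> orient A5 A0 X" unfolding X' using ears st
    by (intro orient_ge_on_segment) (simp_all add: orient_rotate[of A5 A0 A4])
  moreover have "orient X Y Z \<ge> 0"
  proof -
    (* the orientation has the sign of \<sigma> * \<tau>; the third side, parallel to its own diagonal,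
       forces \<sigma> and \<tau> to have the same sign *)
    define \<sigma> \<tau> where "\<sigma> = s' - s" and "\<tau> = t' - t"
    have "Y - X = \<sigma> *\<^sub>R (A3 - A0)" by (simp add: X_def Y_def \<sigma>_def algebra_simps)
    moreover have "Z - X = \<tau> *\<^sub>R (A4 - A1)" by (simp add: X' Z_def \<tau>_def algebra_simps)
    moreover have "Z - Y = (q' - q) *\<^sub>R (A5 - A2)" by (simp add: Y' Z' algebra_simps)
    moreover have "wedge (Z - X) (A5 - A2) = wedge (Y - X) (A5 - A2) + wedge (Z - Y) (A5 - A2)"
      by (simp add: wedge_def algebra_simps)
    moreover have "wedge (r *\<^sub>R u) v = r * wedge u v" "wedge u (r *\<^sub>R v) = r * wedge u v" "wedge u u = 0" for r u v
      by (simp_all add: wedge_def algebra_simps)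
    ultimately have eq: "\<tau> * wedge (A4 - A1) (A5 - A2) = \<sigma> * wedge (A3 - A0) (A5 - A2)"
      and or: "orient X Y Z = \<sigma> * \<tau> * wedge (A3 - A0) (A4 - A1)"
      by (simp_all add: orient_def)
    have W: "wedge (A3 - A0) (A4 - A1) > 0" "wedge (A4 - A1) (A5 - A2) > 0" "wedge (A3 - A0) (A5 - A2) > 0"
      unfolding wedge_diagonals using pos by auto
    have "(\<sigma> * \<tau>) * wedge (A3 - A0) (A5 - A2) = \<tau>\<^sup>2 * wedge (A4 - A1) (A5 - A2)"
      using eq by (simp add: power2_eq_square mult.assoc)
    also have "\<dots> \<ge> 0" using W by simp
    finally have "\<sigma> * \<tau> \<ge> 0" using W(3) by (simp add: zero_le_mult_iff)
    then show ?thesis using or W(1) by simp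
  qed
  moreover have "shoelace 6 C = orient A0 A1 Y + orient A1 A2 Y + orient A2 A3 Z + orient A3 A4 Z +
      orient A4 A5 X + orient A5 A0 X + orient X Y Z"
  proof -
    have "shoelace 6 C = wedge A0 A1 + wedge A1 A2 + wedge A2 A3 + wedge A3 A4 + wedge A4 A5 + wedge A5 A0"
      using C6 by (simp add: shoelace_def A eval_nat_numeral)
    (* three degenerate triangles account for the boundary between the six triangles and X Y Z *)
    moreover have "orient A0 X Y = 0"
      using orient_collinear[of A0 0 "A3 - A0" s s'] by (simp add: X_def Y_def)
    moreover have "orient A2 Y Z = 0"
      using orient_collinear[of A2 0 "A5 - A2" q q'] by (simp add: Y' Z')
    moreover have "orient A4 Z X = 0"
      using orient_collinear[of A1 1 "A4 - A1" t' t] by (simp add: X' Z_def)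
    moreover have "wedge A1 Y = - wedge Y A1" "wedge A3 Z = - wedge Z A3" "wedge A5 X = - wedge X A5"
      by (simp_all add: wedge_def)
    ultimately show ?thesis unfolding orient_wedge by linarith
  qed
  ultimately show ?thesis by linarith
qed

section \<open>Removing a vertex, and the shoelace formula\<close>

text \<open>The increasing enumeration of the indices that are not congruent to \<open>n - 1\<close> modulo \<open>n\<close>, so that
composing with it removes the vertex \<open>C (n - 1)\<close>.\<close>
definition skip_last :: "nat \<Rightarrow> nat \<Rightarrow> nat" where
  "skip_last n i = i + i div (n - 1)"

lemma skip_last_less: "i < n - 1 \<Longrightarrow> skip_last n i = i"
  by (simp add: skip_last_def)

lemma skip_last_ge: "n \<ge> 4 \<Longrightarrow> skip_last n (n - 1) = n" "n \<ge> 4 \<Longrightarrow> skip_last n n = n + 1"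
proof -
  assume n: "n \<ge> 4"
  then show "skip_last n (n - 1) = n" by (simp add: skip_last_def)
  have "n div (n - 1) = 1" using n by (intro div_nat_eqI) auto
  then show "skip_last n n = n + 1" by (simp add: skip_last_def)
qed

lemma cycle_skip_last:
  assumes "convex_cycle n C" "n \<ge> 4"
  shows "convex_cycle (n - 1) (C \<circ> skip_last n)" (is "convex_cycle _ ?B")
    and "range (C \<circ> skip_last n) = range C - {C (n - 1)}"
    and "shoelace n C = shoelace (n - 1) (C \<circ> skip_last n) + ear C (n - 2)"
proof -
  show cyc: "convex_cycle (n - 1) ?B"
  proof (rule cycle_reindex[OF assms(1)])
    show "strict_mono (skip_last n)"
      by (simp add: strict_mono_Suc_iff skip_last_def div_le_mono less_Suc_eq_le add_mono)
    show "skip_last n (i + (n - 1)) = skip_last n i + n" for i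
      using assms(2) div_add_self2[of "n - 1" i] unfolding skip_last_def by linarith
  qed
  have "range ?B = ?B ` {..<n - 1}" using verts_range[OF cyc] assms(2) by simp
  also have "\<dots> = C ` {..<n - 1}" by (intro image_cong) (auto simp: skip_last_less)
  also have "\<dots> = verts n C - {C (n - 1)}"
  proof -
    have "{..<n} = insert (n - 1) {..<n - 1}" using assms(2) by auto
    moreover have "C (n - 1) \<notin> C ` {..<n - 1}"
      using cycle_inj[OF assms(1), of _ "n - 1"] assms(2) by fastforce
    ultimately show ?thesis by auto
  qed
  finally show "range ?B = range C - {C (n - 1)}" using verts_range[OF assms(1)] assms(2) by simp
  define k where "k = n - 2"
  have k: "n = Suc (Suc k)" using assms(2) by (simp add: k_def)
  have "shoelace (n - 1) ?B = (\<Sum>i<k. wedge (C i) (C (i + 1))) + wedge (C k) (C n)"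
    using skip_last_ge[OF assms(2)] by (simp add: shoelace_def k skip_last_less)
  moreover have "shoelace n C = (\<Sum>i<k. wedge (C i) (C (i + 1))) + wedge (C k) (C (k + 1)) + wedge (C (k + 1)) (C n)"
    by (simp add: shoelace_def k)
  moreover have "ear C (n - 2) = wedge (C k) (C (k + 1)) + wedge (C (k + 1)) (C n) - wedge (C k) (C n)"
    by (simp add: k orient_expand algebra_simps)
  ultimately show "shoelace n C = shoelace (n - 1) ?B + ear C (n - 2)" by simp
qed

lemma shoelace_shift:
  assumes "convex_cycle n C"
  shows "shoelace n (\<lambda>i. C (i + r)) = shoelace n C"
proof (induction r)
  case (Suc r)
  define g where "g i = wedge (C (i + r)) (C (i + r + 1))" for i
  have "g n = g 0"
    using cycle_period[OF assms, of r] cycle_period[OF assms, of "r + 1"] by (simp add: g_def add_ac)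
  then have "(\<Sum>i<n. g (Suc i)) = (\<Sum>i<n. g i)"
    using sum.lessThan_Suc_shift[of g n] by simp
  then show ?case using Suc by (simp add: shoelace_def g_def)
qed simp

lemma area_shoelace:
  assumes "convex_cycle n C" "n \<ge> 3"
  shows "area (convex hull (range C)) = shoelace n C / 2"
  using assms(2,1)
proof (induction n arbitrary: C rule: nat_induct_at_least)
  case base
  have C3: "C 3 = C 0" using cycle_period[OF base, of 0] by simp
  have "range C = {C 0, C 1, C 2}"
    using verts_range[OF base] by (auto simp: eval_nat_numeral lessThan_Suc)
  moreover have "orient (C 0) (C 1) (C 2) > 0" using cycle_orient[OF base] by simp
  moreover have "shoelace 3 C = orient (C 0) (C 1) (C 2)"
    using C3 by (simp add: shoelace_def orient_wedge eval_nat_numeral)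
  ultimately show ?case by (simp add: area_triangle)
next
  case (Suc n)
  then have n: "Suc n \<ge> 4" by simp
  note skip = cycle_skip_last[OF Suc.prems n]
  have "area (convex hull (range C)) = area (convex hull (range C - {C n})) + ear C (n - 1) / 2"
    using cycle_area_split[OF Suc.prems, of "n - 1"] Suc.hyps by simp
  also have "area (convex hull (range C - {C n})) = shoelace n (C \<circ> skip_last (Suc n)) / 2"
    using Suc.IH[of "C \<circ> skip_last (Suc n)"] skip(1,2) by (metis diff_Suc_1)
  finally show ?case using skip(3) by simp
qed

section \<open>A vertex whose removal shrinks no ear\<close>

text \<open>The Pluecker relation replaces angles below: it relates the mutual positions of four directions.\<close>
lemma wedge_pluecker:
  "wedge a b * wedge c d - wedge a c * wedge b d + wedge a d * wedge b c = 0"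
  by (simp add: wedge_def algebra_simps)

text \<open>Take \<open>u\<close> horizontal, so that a negative wedge with \<open>u\<close> means descending. The side \<open>e\<close> descends,
is followed by the side \<open>f\<close>, and \<open>w\<close> points from their common vertex back to the start of \<open>u\<close>,
which lies lower and to the left of both. Then \<open>f\<close> descends as well: a convex polygon that has
begun to descend goes on until it closes.\<close>
lemma turn_stays_below:
  assumes "wedge u e < 0" "wedge e f > 0" "wedge e w > 0" "wedge f w > 0" "wedge u w < 0"
  shows "wedge u f < 0"
proof (rule ccontr)
  assume "\<not> wedge u f < 0"
  then have "wedge u f * wedge e w \<ge> 0" using assms by simp
  moreover have "wedge u e * wedge f w < 0" "wedge u w * wedge e f < 0"
    using assms by (simp_all add: mult_neg_pos)
  ultimately show False using wedge_pluecker[of u e f w] by linarith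
qed

text \<open>Among directions in an open half plane, turning left is transitive.\<close>
lemma turn_ordered_below:
  assumes "wedge u e < 0" "wedge u f < 0" "wedge u g < 0" "wedge e f > 0" "wedge f g > 0"
  shows "wedge e g > 0"
proof (rule ccontr)
  assume "\<not> wedge e g > 0"
  then have "wedge u f * wedge e g \<ge> 0" using assms by (simp add: mult_nonpos_nonpos)
  moreover have "wedge u e * wedge f g < 0" "wedge u g * wedge e f < 0"
    using assms by (simp_all add: mult_neg_pos)
  ultimately show False using wedge_pluecker[of u e f g] by linarith
qed

text \<open>The hypothesis says that the two sides next to the side \<open>C 1 C 2\<close> turn by more than a half turn.
All sides from \<open>C 2 C 3\<close> up to \<open>C 5 C 6\<close> then descend relative to the side \<open>C 0 C 1\<close>, so turns
among them are less than a half turn.\<close>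
lemma after_sharp_turn:
  assumes "convex_cycle n C" "n \<ge> 7" "wedge (C 1 - C 0) (C 3 - C 2) < 0"
  shows "wedge (C 3 - C 2) (C 5 - C 4) > 0" "wedge (C 4 - C 3) (C 6 - C 5) > 0"
proof -
  note o = cycle_orient[OF assms(1)]
  let ?e = "\<lambda>i. C (Suc i) - C i"
  have step: "wedge (?e 0) (?e (Suc i)) < 0"
    if "2 \<le> i" "Suc (Suc i) < n" "wedge (?e 0) (?e i) < 0" for i
  proof (rule turn_stays_below[OF that(3), where w = "C 0 - C (Suc i)"])
    have p: "orient (C i) (C (Suc i)) (C (Suc (Suc i))) > 0" "orient (C 0) (C i) (C (Suc i)) > 0"
      "orient (C 0) (C (Suc i)) (C (Suc (Suc i))) > 0" "orient (C 0) (C 1) (C (Suc i)) > 0"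
      by (rule o; use that in simp)+
    show "wedge (?e i) (?e (Suc i)) > 0" using p(1) by (simp add: orient_expand algebra_simps)
    show "wedge (?e i) (C 0 - C (Suc i)) > 0" using p(2) by (simp add: orient_expand algebra_simps)
    show "wedge (?e (Suc i)) (C 0 - C (Suc i)) > 0" using p(3) by (simp add: orient_expand algebra_simps)
    show "wedge (?e 0) (C 0 - C (Suc i)) < 0" using p(4) by (simp add: orient_expand algebra_simps)
  qed
  have consec: "wedge (?e i) (?e (Suc i)) > 0" for i
    using o[of i "Suc i" "Suc (Suc i)"] assms(2) by (simp add: orient_expand algebra_simps)
  have e2: "wedge (?e 0) (?e 2) < 0" using assms(3) by (simp add: eval_nat_numeral)
  have e3: "wedge (?e 0) (?e 3) < 0" using step[of 2] e2 assms(2) by (simp add: eval_nat_numeral)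
  have e4: "wedge (?e 0) (?e 4) < 0" using step[of 3] e3 assms(2) by (simp add: eval_nat_numeral)
  have e5: "wedge (?e 0) (?e 5) < 0" using step[of 4] e4 assms(2) by (simp add: eval_nat_numeral)
  have "wedge (?e 2) (?e 4) > 0"
    using turn_ordered_below[OF e2 e3 e4] consec[of 2] consec[of 3] by (simp add: eval_nat_numeral)
  then show "wedge (C 3 - C 2) (C 5 - C 4) > 0" by (simp add: eval_nat_numeral)
  have "wedge (?e 3) (?e 5) > 0"
    using turn_ordered_below[OF e3 e4 e5] consec[of 3] consec[of 4] by (simp add: eval_nat_numeral)
  then show "wedge (C 4 - C 3) (C 6 - C 5) > 0" by (simp add: eval_nat_numeral)
qed

text \<open>The vertex meant is \<open>C (r + 4)\<close>. Its removal adds the first wedge to the ear at \<open>C (r + 3)\<close> and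
the second to the ear at \<open>C (r + 5)\<close>. If one of them is negative for \<open>r = 0\<close>, it is a sharp
turn, and there is a suitable vertex shortly after it.\<close>
lemma exists_removable_vertex:
  assumes "convex_cycle n C" "n \<ge> 7"
  obtains r where "wedge (C (r + 3) - C (r + 2)) (C (r + 5) - C (r + 4)) \<ge> 0"
    "wedge (C (r + 4) - C (r + 3)) (C (r + 6) - C (r + 5)) \<ge> 0"
proof -
  have *: thesis if "wedge (C (r + 1) - C (r + 0)) (C (r + 3) - C (r + 2)) < 0" for r
  proof -
    have "convex_cycle n (\<lambda>i. C (i + r))" using cycle_shift assms(1) by blast
    from after_sharp_turn[OF this assms(2)] show thesis
      using that \<open>\<And>r. _ r \<Longrightarrow> _ r \<Longrightarrow> thesis\<close>[of r] by (simp add: add.commute)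
  qed
  consider "wedge (C 3 - C 2) (C 5 - C 4) < 0" | "wedge (C 4 - C 3) (C 6 - C 5) < 0"
    | "wedge (C 3 - C 2) (C 5 - C 4) \<ge> 0" "wedge (C 4 - C 3) (C 6 - C 5) \<ge> 0" by linarith
  then show thesis
  proof cases
    case 1
    then show ?thesis using *[of 2] by simp
  next
    case 2
    then show ?thesis using *[of 3] by simp
  next
    case 3
    then show ?thesis using that[of 0] by (simp add: numeral_2_eq_2)
  qed
qed

lemma ears_periodic:
  assumes "convex_cycle n C" "n > 0" "\<And>i. i < n \<Longrightarrow> m \<le> ear C i"
  shows "m \<le> ear C i"
proof -
  have "C (i mod n + k) = C (i + k)" for k
    using cycle_mod[OF assms(1), of "i mod n + k"] cycle_mod[OF assms(1), of "i + k"] by (simp add: mod_simps)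
  from this[of 0] this[of 1] this[of 2] show ?thesis using assms(3)[of "i mod n"] assms(2) by simp
qed

text \<open>After a rotation, the removable vertex is the last one of its period. Removing it changes only
the ears of its two neighbours, which do not shrink, while the doubled area decreases by at
least \<open>m\<close>.\<close>
lemma ear_bound:
  assumes "n \<ge> 6" "convex_cycle n C" "\<And>i. m \<le> ear C i"
  shows "real n * m \<le> shoelace n C"
  using assms
proof (induction n arbitrary: C rule: nat_induct_at_least)
  case base
  then show ?case using hexagon_ear_bound by simp
next
  case (Suc k)
  define n where "n = Suc k"
  have n: "n \<ge> 7" using Suc.hyps by (simp add: n_def)
  have cyc: "convex_cycle n C" using Suc.prems(1) by (simp add: n_def)
  obtain r where r: "wedge (C (r + 3) - C (r + 2)) (C (r + 5) - C (r + 4)) \<ge> 0"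
    "wedge (C (r + 4) - C (r + 3)) (C (r + 6) - C (r + 5)) \<ge> 0"
    using exists_removable_vertex[OF cyc n] by blast
  (* C (r + 4) becomes the last vertex D (n - 1) of a period *)
  define D where "D i = C (i + (r + 5))" for i
  have D: "convex_cycle n D" "shoelace n D = shoelace n C"
    using cycle_shift[OF cyc, of "r + 5"] shoelace_shift[OF cyc, of "r + 5"] by (simp_all add: D_def[abs_def])
  have eD: "m \<le> ear D i" for i
    using Suc.prems(2)[of "i + (r + 5)"] by (simp add: D_def add_ac)
  have "D (n - 3) = C (r + 2)" "D (n - 2) = C (r + 3)" "D (n - 1) = C (r + 4)" "D n = C (r + 5)" "D (n + 1) = C (r + 6)"
    using n cycle_period[OF cyc, of "r + 2"] cycle_period[OF cyc, of "r + 3"] cycle_period[OF cyc, of "r + 4"]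
      cycle_period[OF cyc, of "r + 5"] cycle_period[OF cyc, of "r + 6"] by (simp_all add: D_def add_ac)
  with r have w: "wedge (D (n - 2) - D (n - 3)) (D n - D (n - 1)) \<ge> 0"
    "wedge (D (n - 1) - D (n - 2)) (D (n + 1) - D n) \<ge> 0" by simp_all
  have n4: "n \<ge> 4" using n by simp
  note skip = cycle_skip_last[OF D(1) n4]
  let ?B = "D \<circ> skip_last n"
  have "m \<le> ear ?B i" if i: "i < n - 1" for i
  proof -
    consider "i + 2 < n - 1" | "i = n - 3" | "i = n - 2" using i by linarith
    then show ?thesis
    proof cases
      case 1
      then show ?thesis using eD[of i] by (simp add: skip_last_less)
    next
      case 2
      have "i + 1 = n - 2" "i + 2 = n - 1" using 2 n by simp_all
      with 2 have ix: "skip_last n i = n - 3" "skip_last n (i + 1) = n - 2" "skip_last n (i + 2) = n"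
        using n skip_last_ge(1)[OF n4] by (simp_all only:) (simp_all add: skip_last_less)
      have "ear D (n - 3) = orient (D (n - 3)) (D (n - 2)) (D (n - 1))"
        using n by (simp add: numeral_3_eq_3 numeral_2_eq_2 Suc_diff_Suc)
      moreover have "orient (D (n - 3)) (D (n - 2)) (D n) = orient (D (n - 3)) (D (n - 2)) (D (n - 1)) +
          wedge (D (n - 2) - D (n - 3)) (D n - D (n - 1))"
        by (simp add: orient_expand algebra_simps)
      ultimately show ?thesis using eD[of "n - 3"] w(1) ix by simp
    next
      case 3
      then have ix: "skip_last n i = n - 2" "skip_last n (i + 1) = n" "skip_last n (i + 2) = n + 1"
        using n skip_last_ge[OF n4] by (simp_all add: skip_last_less numeral_2_eq_2 Suc_diff_Suc)
      have "ear D (n - 1) = orient (D (n - 1)) (D n) (D (n + 1))"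
        using n by simp
      moreover have "orient (D (n - 2)) (D n) (D (n + 1)) = orient (D (n - 1)) (D n) (D (n + 1)) +
          wedge (D (n - 1) - D (n - 2)) (D (n + 1) - D n)"
        by (simp add: orient_expand algebra_simps)
      ultimately show ?thesis using eD[of "n - 1"] w(2) ix by simp
    qed
  qed
  then have "m \<le> ear ?B i" for i using ears_periodic[OF skip(1)] n by simp
  then have "real k * m \<le> shoelace k ?B" using Suc.IH[of ?B] skip(1) by (simp add: n_def comp_def)
  then show ?case using skip(3) eD[of "n - 2"] D(2) by (simp add: n_def algebra_simps)
qed

lemma exists_small_ear:
  assumes "convex_cycle n C" "n \<ge> 6"
  obtains i where "real n * (ear C i / 2) \<le> area (convex hull (range C))"
proof -
  obtain i where i: "\<And>j. j < n \<Longrightarrow> ear C i \<le> ear C j"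
  proof -
    have "Min (ear C ` {..<n}) \<in> ear C ` {..<n}"
      using assms(2) by (intro Min_in) (auto simp: lessThan_empty_iff)
    then obtain i where i: "Min (ear C ` {..<n}) = ear C i" by (rule imageE)
    show ?thesis by (rule that[of i], fold i) simp
  qed
  have "real n * ear C i \<le> shoelace n C"
    using ear_bound[OF assms(2,1)] ears_periodic[OF assms(1)] i assms(2) by simp
  then show ?thesis using that area_shoelace[OF assms(1)] assms(2) by simp
qed

section \<open>Convex polygons and their corners\<close>

abbreviation corners :: "(real^2) set \<Rightarrow> (real^2) set" where
  "corners P \<equiv> {v. v extreme_point_of P}"

lemma ngon_corners:
  assumes "convex_ngon n P"
  shows "finite (corners P)" "card (corners P) = n" "P = convex hull corners P"
    "v \<in> corners P \<Longrightarrow> v \<notin> convex hull (corners P - {v})"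
proof -
  have P: "polytope P" "n \<ge> 3" and card: "card (corners P) = n"
    using assms by (auto simp: convex_ngon_def)
  show "card (corners P) = n" by (fact card)
  show "finite (corners P)" using card P(2) by (intro card_ge_0_finite) simp
  show "P = convex hull corners P"
    using Krein_Milman_Minkowski P(1) polytope_imp_compact polytope_imp_convex by blast
  show "v \<notin> convex hull (corners P - {v})" if "v \<in> corners P"
  proof -
    have "convex (P - {v})"
      using that extreme_point_of_stillconvex[OF polytope_imp_convex[OF P(1)]] by simp
    moreover have "corners P - {v} \<subseteq> P - {v}" by (auto simp: extreme_point_of_def)
    ultimately have "convex hull (corners P - {v}) \<subseteq> P - {v}" by (simp add: hull_minimal)
    then show ?thesis by blast
  qed
qed

lemma independent_ngon:
  assumes "finite V" "card V = n" "n \<ge> 3" "\<And>v. v \<in> V \<Longrightarrow> v \<notin> convex hull (V - {v})"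
  shows "corners (convex hull V) = V" "convex_ngon n (convex hull V)"
proof -
  show "corners (convex hull V) = V"
    using extreme_point_of_convex_hull_convex_independent[of V] assms finite_imp_compact by auto
  then show "convex_ngon n (convex hull V)"
    using assms by (auto simp: convex_ngon_def polytope_def)
qed

lemma ngon_cycle:
  assumes "convex_ngon n P"
  obtains C where "convex_cycle n C" "range C = corners P" "P = convex hull range C"
proof -
  have "n \<ge> 3" using assms by (simp add: convex_ngon_def)
  then obtain C where "convex_cycle n C" "range C = corners P"
    using exists_cycle[of "corners P" n] ngon_corners[OF assms] by blast
  then show ?thesis using that ngon_corners(3)[OF assms] by simp
qed

lemma cycle_ngon:
  assumes "convex_cycle n C" "n \<ge> 3"
  shows "convex_ngon n (convex hull range C)"
  using independent_ngon(2)[OF finite_range_cycle[OF assms] _ assms(2) cycle_independent[OF assms]]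
    card_verts[OF assms] verts_range[OF assms(1)] assms(2) by simp

lemma ngon_remove_corner:
  assumes "convex_ngon n P" "n \<ge> 4" "v \<in> corners P"
  shows "convex_ngon (n - 1) (convex hull (corners P - {v}))"
    "convex hull (corners P - {v}) \<subseteq> P"
proof -
  let ?V = "corners P - {v}"
  note V = ngon_corners[OF assms(1)]
  have "w \<notin> convex hull (?V - {w})" if "w \<in> ?V" for w
    using V(4)[of w] that hull_mono[of "?V - {w}" "corners P - {w}" convex] by blast
  moreover have "card ?V = n - 1" using V(2) assms(3) by simp
  ultimately show "convex_ngon (n - 1) (convex hull ?V)"
    using independent_ngon(2)[of ?V "n - 1"] V(1) assms(2) by simp
  have "convex hull ?V \<subseteq> convex hull corners P" by (intro hull_mono) auto
  then show "convex hull ?V \<subseteq> P" using V(3) by simp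
qed

lemma ngon_area_pos:
  assumes "convex_ngon n P" shows "area P > 0"
proof -
  obtain C where C: "convex_cycle n C" "P = convex hull range C" using ngon_cycle[OF assms] by metis
  have n: "n \<ge> 3" using assms by (simp add: convex_ngon_def)
  have "ear C 0 > 0" using cycle_orient[OF C(1)] n by simp
  moreover have "area (convex hull (range C - {C (0 + 1)})) \<ge> 0" by simp
  ultimately have "area (convex hull range C) > 0" using cycle_area_split[OF C(1) n, of 0] by linarith
  then show ?thesis using C(2) by simp
qed

lemma ngon_area_mono:
  assumes "convex_ngon m Q" "convex_ngon n P" "Q \<subseteq> P"
  shows "area Q \<le> area P"
  using area_hull_mono[of "corners Q" "corners P"] ngon_corners[OF assms(1)] ngon_corners[OF assms(2)] assms(3)
  by simp

text \<open>Points on a parabola are in convex position: their orientations are Vandermonde determinants.\<close>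
lemma exists_ngon: assumes "n \<ge> 3" obtains P where "convex_ngon n P"
proof -
  define A :: "nat \<Rightarrow> real^2" where "A i = vector [real i, (real i)\<^sup>2]" for i
  have "orient (A i) (A j) (A k) > 0" if "i < j" "j < k" for i j k
  proof -
    have "orient (A i) (A j) (A k) = (real j - real i) * (real k - real j) * (real k - real i)"
      by (simp add: A_def orient_expand power2_eq_square algebra_simps)
    then show ?thesis using that by simp
  qed
  then have "convex_cycle n (\<lambda>i. A (i mod n))" by (intro cycle_of_order)
  then show ?thesis using cycle_ngon assms that by blast
qed

section \<open>The largest inscribed polygon with one vertex less\<close>

lemma area_two_points: "area (convex hull {a, b}) = 0"
  using area_triangle[of a b b] by simp

text \<open>A point \<open>s\<close> of \<open>S\<close> that is no extreme point of the hull is dropped. Otherwise the ear at \<open>s\<close>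
with base \<open>ab\<close> is replaced by the triangle over the same base with apex at a point of \<open>V\<close>: the
distance from the line \<open>ab\<close> is an affine functional, so its largest value on the hull of \<open>V\<close> is
attained in \<open>V\<close>. The induction measure counts the points of \<open>S\<close> and, again, those outside \<open>V\<close>,
as the first kind of step lowers the one and the second kind the other.\<close>
lemma move_to_corners:
  assumes "finite V" "finite S" "S \<subseteq> convex hull V"
  shows "\<exists>T\<subseteq>V. card T \<le> card S \<and> area (convex hull S) \<le> area (convex hull T)"
  using assms(2,3)
proof (induction "card S + card (S - V)" arbitrary: S rule: less_induct)
  case less
  consider "S \<subseteq> V" | s where "s \<in> S" "s \<in> convex hull (S - {s})"
    | "card S \<le> 2"
    | s where "s \<in> S" "s \<notin> V" "card S \<ge> 3" "\<And>v. v \<in> S \<Longrightarrow> v \<notin> convex hull (S - {v})"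
    by (metis not_less_eq_eq numeral_2_eq_2 numeral_3_eq_3 subsetI)
  then show ?case
  proof cases
    case 1
    then show ?thesis by blast
  next
    case 2
    then have "convex hull S = convex hull (S - {s})"
      using hull_redundant[of s convex "S - {s}"] by (simp add: insert_absorb)
    moreover have "card (S - {s}) < card S" using 2 less.prems(1) by (intro card_Diff1_less)
    moreover have "card (S - {s} - V) \<le> card (S - V)" using less.prems(1) by (intro card_mono) auto
    ultimately show ?thesis
      using less.hyps[of "S - {s}"] less.prems by (smt (verit) Diff_subset add_less_le_mono finite_Diff le_trans less_imp_le subset_trans)
  next
    case 3
    then have "card S = 0 \<or> card S = 1 \<or> card S = 2" by linarith
    then consider "S = {}" | "card S = 1" | "card S = 2" using less.prems(1) by auto
    then have "\<exists>a b. S \<subseteq> {a, b}"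
    proof cases
      case 2
      then show ?thesis by (metis card_1_singletonE insert_absorb2 subset_refl)
    next
      case 3
      then show ?thesis by (metis card_2_iff subset_refl)
    qed auto
    then obtain a b where "S \<subseteq> {a, b}" by blast
    then have "area (convex hull S) \<le> area (convex hull {a, b})"
      using less.prems(1) by (intro area_hull_mono hull_mono) auto
    (* two points span no area, so the empty set does as well *)
    then have "area (convex hull S) \<le> area (convex hull {})" by (simp add: area_two_points)
    then show ?thesis by (intro exI[of _ "{}"]) auto
  next
    case 4
    obtain C where C: "convex_cycle (card S) C" "range C = S"
      using exists_cycle[OF less.prems(1) refl 4(3,4)] by blast
    obtain i where i: "s = C (i + 1)" using cycle_Suc_surj[OF C(1), of s] 4(1,3) C(2) by auto
    define a b where "a = C i" and "b = C (i + 2)"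
    have "\<exists>x\<in>V. orient a b x \<le> orient a b s"
    proof (rule ccontr)
      assume "\<not> ?thesis"
      then have lt: "\<And>x. x \<in> V \<Longrightarrow> orient a b x > orient a b s" by auto
      obtain w where w: "\<And>x. orient a b x = w \<bullet> x - w \<bullet> a" using orient_inner by metis
      have "convex hull V \<subseteq> {x. w \<bullet> x > w \<bullet> s}"
        using lt w by (intro hull_minimal convex_halfspace_gt) auto
      then show False using 4(1) less.prems(2) by auto
    qed
    then obtain x where x: "x \<in> V" "orient a b x \<le> orient a b s" by blast
    have up: "orient a s b \<le> orient a x b"
      using x(2) orient_swap[of a s b] orient_swap[of a x b] by simp
    have split: "area (convex hull S) = area (convex hull (S - {s})) + orient a s b / 2"
      using cycle_area_split[OF C(1) 4(3), of i] C(2) i by (simp add: a_def b_def)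
    have epos: "orient a s b > 0"
      using cycle_orient[OF C(1), of i "i + 1" "i + 2"] 4(3) i by (simp add: a_def b_def)
    have "area (convex hull (S - {s})) + orient a x b / 2 \<le> area (convex hull (insert x (S - {s})))"
    proof (rule area_add_triangle_le)
      show "a \<in> S - {s}" "b \<in> S - {s}" using cycle_ends_in[OF C(1) 4(3), of i] C(2) i by (auto simp: a_def b_def)
      show "a \<noteq> b" using epos by auto
      show "orient a b y \<ge> 0" if "y \<in> S - {s}" for y
        using ear_sides(3)[OF C(1) 4(3), of y i] C(2) i that by (simp add: a_def b_def)
    qed (use up epos less.prems(1) in auto)
    then have le: "area (convex hull S) \<le> area (convex hull (insert x (S - {s})))"
      using split up by simp
    have c1: "card (insert x (S - {s})) \<le> card S"
      using 4(1) less.prems(1) by (metis Suc_pred card_Diff_singleton card_gt_0_iff card_insert_le_m1 empty_iff order_refl)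
    have "insert x (S - {s}) - V = S - V - {s}" using x(1) by auto
    then have c2: "card (insert x (S - {s}) - V) < card (S - V)"
      using 4(1,2) less.prems(1) by (metis card_Diff1_less DiffI finite_Diff)
    have "insert x (S - {s}) \<subseteq> convex hull V" using x(1) less.prems(2) hull_inc[of x V convex] by auto
    then obtain T where "T \<subseteq> V" "card T \<le> card (insert x (S - {s}))"
      "area (convex hull (insert x (S - {s}))) \<le> area (convex hull T)"
      using less.hyps[of "insert x (S - {s})"] c1 c2 less.prems(1) by auto
    then show ?thesis using le c1 by (meson le_trans order_trans)
  qed
qed

lemma inscribed_le_remove_corner:
  assumes "convex_ngon n P" "convex_ngon (n - 1) Q" "Q \<subseteq> P"
  obtains v where "v \<in> corners P" "area Q \<le> area (convex hull (corners P - {v}))"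
proof -
  note P = ngon_corners[OF assms(1)] and Q = ngon_corners[OF assms(2)]
  have n: "n \<ge> 4" using assms(1,2) by (auto simp: convex_ngon_def)
  have "corners Q \<subseteq> convex hull corners P"
    using P(3) assms(3) by (auto simp: extreme_point_of_def)
  then obtain T where T: "T \<subseteq> corners P" "card T \<le> n - 1"
    "area (convex hull corners Q) \<le> area (convex hull T)"
    using move_to_corners[OF P(1) Q(1)] Q(2) by auto
  then have "T \<noteq> corners P" using P(2) n by auto
  then obtain v where v: "v \<in> corners P" "v \<notin> T" using T(1) by blast
  have "area (convex hull T) \<le> area (convex hull (corners P - {v}))"
    using T(1) v P(1) by (intro area_hull_mono hull_mono finite_subset[OF T(1)]) auto
  then show ?thesis using that v(1) T(3) Q(3) by simp
qed

section \<open>Cyclic listings of the vertices\<close>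

text \<open>Any other diagonal from \<open>C (i + 1)\<close> to some \<open>C k\<close> is crossed by the segment from \<open>C (i + 2)\<close> to
\<open>C (k + 1)\<close>. If it were a face, it would contain the ends of that segment.\<close>
lemma edge_joins_neighbours:
  assumes "convex_cycle n C" "n \<ge> 3" "w \<in> range C - {C (i + 1)}"
    and face: "closed_segment (C (i + 1)) w face_of convex hull range C"
  shows "w = C i \<or> w = C (i + 2)"
  using assms(1-3)
proof (cases rule: cycle_others)
  case (3 k)
  note o = cycle_orient[OF assms(1)]
  let ?a = "C (i + 1)" and ?b = "C (i + 2)" and ?d = "C (k + 1)"
  have pos: "orient ?a ?b (C k) > 0" "orient ?a (C k) ?d > 0" "orient ?a ?b ?d > 0" "orient ?b (C k) ?d > 0"
    by (rule o; use 3 in simp)+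
  obtain s t where st: "0 < s" "s < 1" "0 < t" "t < 1"
    "?a + s *\<^sub>R (C k - ?a) = ?b + t *\<^sub>R (?d - ?b)"
    by (rule quadrilateral_diagonals_cross[OF pos])
  define x where "x = ?a + s *\<^sub>R (C k - ?a)"
  have xF: "x \<in> closed_segment ?a w"
    unfolding in_segment x_def using st 3 by (intro exI[of _ s]) (simp add: algebra_simps)
  have "?b \<noteq> ?d" using pos(4) by auto
  then have "x \<in> open_segment ?b ?d"
    unfolding in_segment x_def st(5) using st by (intro conjI exI[of _ t]) (auto simp: algebra_simps)
  then have "?b \<in> closed_segment ?a w"
    using face_ofD[OF face, of x ?b ?d] xF by (meson hull_inc rangeI)
  then have "?b \<in> convex hull {?a, w}" by (simp add: segment_convex_hull)
  moreover have "{?a, w} \<subseteq> range C - {?b}" using pos(1) 3 by auto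
  ultimately have "?b \<in> convex hull (range C - {?b})" using hull_mono by blast
  then show ?thesis using cycle_independent[OF assms(1,2)] by blast
qed auto

text \<open>All other vertices lie strictly to the left of the line through two consecutive ones, which
makes the side a face.\<close>
lemma cyclic_vertices_of_cycle:
  assumes "convex_cycle n C" "n \<ge> 3"
  shows "cyclic_vertices n C" "C ` {1..n} = range C"
proof -
  show win: "C ` {1..n} = range C"
    using cycle_window[OF assms, of 0] by (simp add: atLeastLessThanSuc_atLeastAtMost)
  have "closed_segment (C k) (C (k + 1)) edge_of convex hull range C" for k
  proof -
    let ?T = "{C k, C (k + 1)}"
    have "affine hull ?T \<subseteq> {x. orient (C k) (C (k + 1)) x = 0}"
    proof
      fix x assume "x \<in> affine hull ?T"
      then obtain u v where uv: "u + v = 1" "x = u *\<^sub>R C k + v *\<^sub>R C (k + 1)"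
        by (auto simp: affine_hull_2)
      then have u: "u = 1 - v" by simp
      have x: "x = C k + v *\<^sub>R (C (k + 1) - C k)"
        using uv(2) unfolding u by (simp add: algebra_simps)
      show "x \<in> {x. orient (C k) (C (k + 1)) x = 0}"
        unfolding x by (simp add: orient_expand algebra_simps)
    qed
    moreover have "orient (C k) (C (k + 1)) q > 0" if "q \<in> range C - ?T" for q
    proof -
      have "q \<in> range C - {C (k + 1)}" using that by auto
      with assms show ?thesis
      proof (cases rule: cycle_others)
        case 1
        then show ?thesis using that by simp
      next
        case 2
        then show ?thesis using cycle_orient[OF assms(1), of k "k + 1" "k + 2"] assms(2) by simp
      next
        case (3 j)
        then show ?thesis using cycle_orient[OF assms(1), of k "k + 1" j] by simp
      qed
    qed
    ultimately have "affine hull ?T \<inter> convex hull (range C - ?T) = {}"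
      using orient_hull(3)[of _ "range C - ?T" "C k" "C (k + 1)"] by fastforce
    then have "convex hull ?T face_of convex hull range C"
      using finite_range_cycle[OF assms] by (intro face_of_convex_hulls) auto
    moreover have "aff_dim (convex hull ?T) = 1"
      using cycle_inj[OF assms, of k "k + 1"] assms(2) by (simp add: aff_dim_convex_hull)
    ultimately show ?thesis by (simp add: edge_of_def segment_convex_hull)
  qed
  then show "cyclic_vertices n C"
    using cycle_ngon[OF assms] cycle_period[OF assms(1), of 0] cycle_period[OF assms(1), of 1]
    unfolding cyclic_vertices_def win by simp
qed

lemma cyclic_vertices_corners:
  assumes "cyclic_vertices n A"
  shows "corners (convex hull (A ` {1..n})) = A ` {1..n}" "inj_on A {1..n}"
proof -
  have "convex_ngon n (convex hull (A ` {1..n}))" using assms by (simp add: cyclic_vertices_def)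
  note c = ngon_corners[OF this]
  have "corners (convex hull (A ` {1..n})) \<subseteq> A ` {1..n}" by (rule extreme_points_of_convex_hull)
  moreover have "card (A ` {1..n}) \<le> n" using card_image_le[of "{1..n}" A] by simp
  ultimately show eq: "corners (convex hull (A ` {1..n})) = A ` {1..n}"
    using c(2) by (intro card_seteq) auto
  show "inj_on A {1..n}" using c(2) eq by (intro eq_card_imp_inj_on) auto
qed

text \<open>The two edges at \<open>A k\<close> lead to different neighbours in the periodic listing of the polygon,
hence to both of them, so the triangle is an ear there.\<close>
lemma cyclic_vertices_ear:
  assumes A: "cyclic_vertices n A" and k: "k \<in> {1..n}"
  shows "area (convex hull {A (k - 1), A k, A (k + 1)}) =
    area (convex hull (A ` {1..n})) - area (convex hull (A ` {1..n} - {A k}))"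
proof -
  define P where "P = convex hull (A ` {1..n})"
  have P: "convex_ngon n P" and per: "A 0 = A n" "A (n + 1) = A 1"
    and edge: "\<And>k. k \<in> {1..n} \<Longrightarrow> closed_segment (A k) (A (k + 1)) edge_of P"
    using A by (auto simp: cyclic_vertices_def P_def)
  have n: "n \<ge> 3" using P by (simp add: convex_ngon_def)
  have cor: "corners P = A ` {1..n}" and inj: "inj_on A {1..n}"
    using cyclic_vertices_corners[OF A] by (simp_all add: P_def)
  obtain C where C: "convex_cycle n C" "range C = A ` {1..n}" using ngon_cycle[OF P] cor by metis
  obtain i where i: "A k = C (i + 1)" using cycle_Suc_surj[OF C(1), of "A k"] C(2) k n by auto
  (* the neighbours of k as indices within 1..n, where A is injective *)
  define p q where "p = (if k = 1 then n else k - 1)" and "q = (if k = n then 1 else k + 1)"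
  have pq: "p \<in> {1..n}" "q \<in> {1..n}" "p \<noteq> q" "p \<noteq> k" "q \<noteq> k" using k n by (auto simp: p_def q_def)
  have Apq: "A p = A (k - 1)" "A q = A (k + 1)" using per by (auto simp: p_def q_def)
  have ne: "A p \<noteq> A q" "A p \<noteq> A k" "A q \<noteq> A k" using pq k inj by (auto simp: inj_on_eq_iff)
  have "closed_segment (A k) (A q) face_of P" using edge[OF k] Apq by (simp add: edge_of_def)
  moreover have "closed_segment (A k) (A p) face_of P"
  proof -
    have "A (p + 1) = A k" using per k by (auto simp: p_def)
    then show ?thesis using edge[OF pq(1)] by (simp add: edge_of_def closed_segment_commute)
  qed
  ultimately have "A q = C i \<or> A q = C (i + 2)" "A p = C i \<or> A p = C (i + 2)"
    using edge_joins_neighbours[OF C(1) n, of _ i] ne pq C(2) i by (auto simp: P_def)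
  then have "{A (k - 1), A k, A (k + 1)} = {C i, C (i + 1), C (i + 2)}"
    using ne(1) i Apq by auto
  then have "area (convex hull {A (k - 1), A k, A (k + 1)}) = ear C i / 2"
    using cycle_orient[OF C(1), of i "i + 1" "i + 2"] n by (simp add: area_triangle)
  then show ?thesis using cycle_area_split[OF C(1) n, of i] C(2) i by simp
qed

section \<open>The extremal ratios\<close>

abbreviation inscribed :: "nat \<Rightarrow> (real^2) set \<Rightarrow> (real^2) set set" where
  "inscribed m P \<equiv> {Q. convex_ngon m Q \<and> Q \<subseteq> P}"

lemma inscribed_ratio_le_1:
  assumes "convex_ngon n P" "Q \<in> inscribed m P"
  shows "area Q / area P \<le> 1"
  using ngon_area_mono[of m Q n P] ngon_area_pos[OF assms(1)] assms by (auto simp: divide_le_eq_1)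

text \<open>The complement of the smallest ear is itself an inscribed \<open>(n - 1)\<close>-gon, so the supremum is a
maximum.\<close>
lemma min_ear_eq:
  assumes "cyclic_vertices n A" "n \<ge> 4"
  shows "(MIN k\<in>{1..n}. area (convex hull {A (k - 1), A k, A (k + 1)}) / area (convex hull (A ` {1..n}))) =
    1 - (SUP Q\<in>inscribed (n - 1) (convex hull (A ` {1..n})). area Q / area (convex hull (A ` {1..n})))"
proof -
  define P where "P = convex hull (A ` {1..n})"
  have P: "convex_ngon n P" using assms(1) by (simp add: cyclic_vertices_def P_def)
  have cor: "corners P = A ` {1..n}" using cyclic_vertices_corners[OF assms(1)] by (simp add: P_def)
  have pos: "area P > 0" using ngon_area_pos[OF P] .
  define e where "e k = area (convex hull {A (k - 1), A k, A (k + 1)}) / area P" for k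
  have e: "area (convex hull (corners P - {A k})) / area P = 1 - e k" if "k \<in> {1..n}" for k
  proof -
    have "area (convex hull (corners P - {A k})) = area P - area (convex hull {A (k - 1), A k, A (k + 1)})"
      using cyclic_vertices_ear[OF assms(1) that] unfolding cor unfolding P_def by simp
    then show ?thesis using pos by (simp add: e_def diff_divide_distrib)
  qed
  have fin: "finite (e ` {1..n})" "e ` {1..n} \<noteq> {}" using assms(2) by auto
  have "Min (e ` {1..n}) \<in> e ` {1..n}" using fin by (rule Min_in)
  then obtain k where k: "k \<in> {1..n}" "Min (e ` {1..n}) = e k" by auto
  have "(SUP Q\<in>inscribed (n - 1) P. area Q / area P) = 1 - e k"
  proof (rule cSup_eq_maximum)
    show "1 - e k \<in> (\<lambda>Q. area Q / area P) ` inscribed (n - 1) P"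
      using ngon_remove_corner[OF P assms(2), of "A k"] cor k(1) e[OF k(1)]
      by (intro image_eqI[of _ _ "convex hull (corners P - {A k})"]) auto
    fix r assume "r \<in> (\<lambda>Q. area Q / area P) ` inscribed (n - 1) P"
    then obtain Q where Q: "r = area Q / area P" "convex_ngon (n - 1) Q" "Q \<subseteq> P" by auto
    obtain v where v: "v \<in> corners P" "area Q \<le> area (convex hull (corners P - {v}))"
      by (rule inscribed_le_remove_corner[OF P Q(2,3)])
    then obtain j where j: "j \<in> {1..n}" "v = A j" using cor by auto
    have "r \<le> 1 - e j" using v(2) j e[OF j(1)] pos Q(1) by (metis divide_right_mono less_imp_le)
    moreover have "e k \<le> e j" using Min_le[OF fin(1)] k(2) j(1) by (metis imageI)
    ultimately show "r \<le> 1 - e k" by simp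
  qed
  then show ?thesis using k(2) by (simp add: e_def[abs_def] P_def)
qed

lemma Sup_one_minus:
  fixes X :: "real set"
  assumes "X \<noteq> {}" "bdd_below X"
  shows "Sup ((\<lambda>x. 1 - x) ` X) = 1 - Inf X"
proof (rule antisym)
  show "Sup ((\<lambda>x. 1 - x) ` X) \<le> 1 - Inf X"
    using assms by (intro cSUP_least) (auto intro: cInf_lower)
  obtain c where c: "\<And>x. x \<in> X \<Longrightarrow> c \<le> x" using assms(2) by (auto simp: bdd_below_def)
  have "bdd_above ((\<lambda>x. 1 - x) ` X)" by (rule bdd_aboveI2[of _ _ "1 - c"]) (use c in auto)
  then have "1 - Sup ((\<lambda>x. 1 - x) ` X) \<le> x" if "x \<in> X" for x
    using cSUP_upper[OF that, of "\<lambda>x. 1 - x"] by simp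
  then have "1 - Sup ((\<lambda>x. 1 - x) ` X) \<le> Inf X" using assms(1) by (intro cInf_greatest)
  then show "1 - Inf X \<le> Sup ((\<lambda>x. 1 - x) ` X)" by simp
qed

text \<open>Cutting off a small ear of an \<open>n\<close>-gon keeps the fraction \<open>(n - 1) / n\<close> of the area; these
fractions telescope.\<close>
lemma exists_large_inscribed:
  assumes "m \<ge> 5" "m \<le> n" "convex_ngon n P"
  shows "\<exists>Q\<in>inscribed m P. real m / real n * area P \<le> area Q"
  using assms(2,3)
proof (induction n arbitrary: P rule: dec_induct)
  case base
  then show ?case using assms(1) by (intro bexI[of _ P]) auto
next
  case (step n)
  have n: "Suc n \<ge> 6" using step.hyps assms(1) by simp
  obtain C where C: "convex_cycle (Suc n) C" "range C = corners P" "P = convex hull range C"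
    by (rule ngon_cycle[OF step.prems])
  obtain i where i: "real (Suc n) * (ear C i / 2) \<le> area (convex hull (range C))"
    by (rule exists_small_ear[OF C(1) n])
  define R where "R = convex hull (corners P - {C (i + 1)})"
  have R: "convex_ngon n R" "R \<subseteq> P"
    using ngon_remove_corner[OF step.prems _ rangeI[of C "i + 1", unfolded C(2)]] n by (simp_all add: R_def)
  have hull: "area (convex hull (range C)) = area P" by (simp only: C(3)[symmetric])
  have "area P = area R + ear C i / 2"
    using cycle_area_split[OF C(1), of i] n hull unfolding R_def C(2)[symmetric] by simp
  with i have "real n * area P \<le> real (Suc n) * area R"
    unfolding hull by (simp add: algebra_simps)
  obtain Q where Q: "convex_ngon m Q" "Q \<subseteq> R" "real m / real n * area R \<le> area Q"
    using step.IH[OF R(1)] by auto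
  have npos: "real n > 0" using n by simp
  have "real m / real (Suc n) * area P = real m / (real n * real (Suc n)) * (real n * area P)"
    using npos by simp
  also have "\<dots> \<le> real m / (real n * real (Suc n)) * (real (Suc n) * area R)"
    using \<open>real n * area P \<le> real (Suc n) * area R\<close> by (intro mult_left_mono) auto
  also have "\<dots> = real m / real n * area R" by (simp del: of_nat_Suc)
  also have "\<dots> \<le> area Q" by (rule Q(3))
  finally show ?case using Q(1,2) R(2) by (intro bexI[of _ Q]) auto
qed

lemma f_ratio_ge:
  assumes "m \<ge> 5" "m < n"
  shows "real m / real n \<le> f_ratio n m"
  unfolding f_ratio_def
proof (rule cINF_greatest)
  show "{P. convex_ngon n P} \<noteq> {}" using exists_ngon[of n] assms by auto
  fix P assume "P \<in> {P. convex_ngon n P}"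
  then have P: "convex_ngon n P" by simp
  obtain Q where Q: "Q \<in> inscribed m P" "real m / real n * area P \<le> area Q"
    using exists_large_inscribed[OF assms(1) _ P] assms(2) by auto
  have "real m / real n \<le> area Q / area P"
    using Q(2) ngon_area_pos[OF P] by (simp add: pos_le_divide_eq)
  also have "\<dots> \<le> (SUP Q\<in>inscribed m P. area Q / area P)"
    using Q(1) inscribed_ratio_le_1[OF P] by (intro cSUP_upper bdd_aboveI2[of _ _ 1]) auto
  finally show "real m / real n \<le> (SUP Q\<in>inscribed m P. area Q / area P)" .
qed

text \<open>Both sides range over the same polygons, as every polygon has a cyclic listing of its vertices;
the passage to the complement turns the infimum into a supremum.\<close>
lemma g_ratio_eq:
  assumes "n \<ge> 4"
  shows "g_ratio n = 1 - f_ratio n (n - 1)"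
proof -
  define \<phi> where "\<phi> P = (SUP Q\<in>inscribed (n - 1) P. area Q / area P)" for P
  have polys: "(\<lambda>A. convex hull (A ` {1..n})) ` {A. cyclic_vertices n A} = {P. convex_ngon n P}"
  proof
    show "{P. convex_ngon n P} \<subseteq> (\<lambda>A. convex hull (A ` {1..n})) ` {A. cyclic_vertices n A}"
    proof
      fix P assume "P \<in> {P. convex_ngon n P}"
      then obtain C where "convex_cycle n C" "P = convex hull range C" using ngon_cycle by blast
      then show "P \<in> (\<lambda>A. convex hull (A ` {1..n})) ` {A. cyclic_vertices n A}"
        using cyclic_vertices_of_cycle[of n C] assms by (intro image_eqI[of _ _ C]) auto
    qed
  qed (auto simp: cyclic_vertices_def)
  have "g_ratio n = (SUP A\<in>{A. cyclic_vertices n A}. 1 - \<phi> (convex hull (A ` {1..n})))"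
    unfolding g_ratio_def \<phi>_def using min_ear_eq assms by (intro SUP_cong) auto
  also have "\<dots> = Sup ((\<lambda>x. 1 - x) ` \<phi> ` {P. convex_ngon n P})"
    unfolding polys[symmetric] by (simp add: image_image)
  also have "\<dots> = 1 - Inf (\<phi> ` {P. convex_ngon n P})"
  proof (rule Sup_one_minus)
    show "\<phi> ` {P. convex_ngon n P} \<noteq> {}" using exists_ngon[of n] assms by auto
    have "0 \<le> \<phi> P" if P: "convex_ngon n P" for P
    proof -
      obtain v where "v \<in> corners P" using ngon_corners(2)[OF P] assms by fastforce
      then have Q: "convex hull (corners P - {v}) \<in> inscribed (n - 1) P"
        using ngon_remove_corner[OF P assms] by simp
      have "0 \<le> area (convex hull (corners P - {v})) / area P" by simp
      also have "\<dots> \<le> \<phi> P" unfolding \<phi>_def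
        using Q inscribed_ratio_le_1[OF P] by (intro cSUP_upper bdd_aboveI2[of _ _ 1]) auto
      finally show ?thesis .
    qed
    then show "bdd_below (\<phi> ` {P. convex_ngon n P})" by (intro bdd_belowI2[of _ 0]) auto
  qed
  finally show ?thesis by (simp add: f_ratio_def \<phi>_def)
qed

theorem corollary4p3:
  "(\<forall>n::nat. n \<ge> 6 \<longrightarrow>
      g_ratio n = 1 - f_ratio n (n - 1) \<and> 1 - f_ratio n (n - 1) \<le> 1 / real n) \<and>
   (\<forall>m n::nat. 5 \<le> m \<and> m < n \<longrightarrow> f_ratio n m \<ge> real m / real n)"
proof (intro conjI allI impI)
  fix n :: nat assume n: "n \<ge> 6"
  show "g_ratio n = 1 - f_ratio n (n - 1)" using g_ratio_eq n by simp
  have "real (n - 1) / real n \<le> f_ratio n (n - 1)" using f_ratio_ge[of "n - 1" n] n by simp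
  moreover have "real (n - 1) / real n = 1 - 1 / real n" using n by (simp add: of_nat_diff diff_divide_distrib)
  ultimately show "1 - f_ratio n (n - 1) \<le> 1 / real n" by simp
next
  fix m n :: nat assume "5 \<le> m \<and> m < n"
  then show "f_ratio n m \<ge> real m / real n" using f_ratio_ge by simp
qed

end
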